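(* Under the Setup and the Conditional asymptotic regime described in the context, for $i,j\in\{0,1\}$, $$\lim_{p\to\infty}E_{S_n}[\hat\varepsilon_i^B\hat\varepsilon_j^B\mid\boldsymbol\mu]=\Phi\!\left((-1)^i\frac{-G_i^B+c}{\sqrt D}\right)\Phi\!\left((-1)^j\frac{-G_j^B+c}{\sqrt D}\right),$$ and consequently $$\lim_{p\to\infty}E_{S_n}[(\hat\varepsilon^B)^2\mid\boldsymbol\mu]=\left[\alpha_0\Phi\!\left(\frac{-G_0^B+c}{\sqrt D}\right)+\alpha_1\Phi\!\left(\frac{G_1^B-c}{\sqrt D}\right)\right]^2,$$ where $G_0^B=\frac{1}{2(1+\gamma_0)}\big(\gamma_0(\bar\eta_{\mathbf m_0,\boldsymbol\mu_1}-\bar\eta_{\mathbf m_0,\boldsymbol\mu_0})+\bar\delta^2_{\boldsymbol\mu}+(1-\gamma_0)J_0+(1+\gamma_0)J_1\big)$, $G_1^B=\frac{-1}{2(1+\gamma_1)}\big(\gamma_1(\bar\eta_{\mathbf m_1,\boldsymbol\mu_0}-\bar\eta_{\mathbf m_1,\boldsymbol\mu_1})+\bar\delta^2_{\boldsymbol\mu}+(1-\gamma_1)J_1+(1+\gamma_1)J_0\big)$, and $D=\bar\delta^2_{\boldsymbol\mu}+J_0+J_1$.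
   Context: Setup. Fix $\alpha_0\in(0,1)$, $\alpha_1=1-\alpha_0$, and $c=\log\frac{1-\alpha_0}{\alpha_0}$. $\Phi$ is the standard normal CDF. For each dimension $p$ there is a known symmetric positive definite $p\times p$ matrix $\Sigma$, class means $\boldsymbol\mu_0,\boldsymbol\mu_1\in\mathbb R^p$, sample sizes $n_0,n_1$, prior means $\mathbf m_0,\mathbf m_1\in\mathbb R^p$ and prior certainty parameters $\nu_0,\nu_1>0$ (all depending on $p$; the index $p$ is suppressed). Class $i$ has distribution $\Pi_i=N(\boldsymbol\mu_i,\Sigma)$. The sample $S_n$ consists of $n_0$ i.i.d. points from $\Pi_0$ and, independently, $n_1$ i.i.d. points from $\Pi_1$; $\bar{\mathbf x}_0,\bar{\mathbf x}_1$ are the class sample means. The LDA classifier assigns $\mathbf x$ to class 1 if $W(\mathbf x)\le c$ and to class 0 otherwise, where $W(\mathbf x)=(\mathbf x-\frac{\bar{\mathbf x}_0+\bar{\mathbf x}_1}{2})^T\Sigma^{-1}(\bar{\mathbf x}_0-\bar{\mathbf x}_1)$. Let $\hat\delta^2=(\bar{\mathbf x}_0-\bar{\mathbf x}_1)^T\Sigma^{-1}(\bar{\mathbf x}_0-\bar{\mathbf x}_1)$. The true error is $\varepsilon=\alpha_0\varepsilon_0+\alpha_1\varepsilon_1$ with $\varepsilon_i=\Phi\Big(\frac{(-1)^{i+1}(\boldsymbol\mu_i-\frac{\bar{\mathbf x}_0+\bar{\mathbf x}_1}{2})^T\Sigma^{-1}(\bar{\mathbf x}_0-\bar{\mathbf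 x}_1)+(-1)^i c}{\hat\delta}\Big)$. The Bayesian MMSE error estimator (for the prior $\boldsymbol\mu_i\sim N(\mathbf m_i,\Sigma/\nu_i)$, $i=0,1$, independent) is $\hat\varepsilon^B=\alpha_0\hat\varepsilon^B_0+\alpha_1\hat\varepsilon^B_1$ with $\hat\varepsilon_i^B=\Phi\Big((-1)^i\frac{-(\mathbf m_i^*-\frac{\bar{\mathbf x}_0+\bar{\mathbf x}_1}{2})^T\Sigma^{-1}(\bar{\mathbf x}_0-\bar{\mathbf x}_1)+c}{\hat\delta}\sqrt{\frac{\nu_i^*}{\nu_i^*+1}}\Big)$, where $\mathbf m_i^*=\frac{n_i\bar{\mathbf x}_i+\nu_i\mathbf m_i}{n_i+\nu_i}$ and $\nu_i^*=n_i+\nu_i$. Notation: $\eta_{\mathbf a,\mathbf b}=(\mathbf a-\mathbf b)^T\Sigma^{-1}(\mathbf a-\mathbf b)$, $\delta^2_{\boldsymbol\mu}=\eta_{\boldsymbol\mu_0,\boldsymbol\mu_1}$; a bar denotes the limit as $p\to\infty$ of the corresponding quantity. Conditional asymptotic regime. $\boldsymbol\mu_0,\boldsymbol\mu_1$ are deterministic for each $p$, and expectations $E_{S_n}[\cdot\mid\boldsymbol\mu]$ are over the sample only. As $p\to\infty$: $n_0,n_1,\nu_0,\nu_1\to\infty$, $p/n_i\to J_i\in[0,\infty)$, $\nu_i/n_i\to\gamma_i\in[0,\infty)$, and for all $i,j\in\{0,1\}$ the quantities $\mathbf m_i^T\Sigma^{-1}\boldsymbol\mu_j$, $\mathbf m_i^T\Sigma^{-1}\mathbf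 m_j$, $\boldsymbol\mu_i^T\Sigma^{-1}\boldsymbol\mu_j$ converge to finite limits (so all the $\eta$'s above converge). It is assumed that $D=\bar\delta^2_{\boldsymbol\mu}+J_0+J_1>0$. $\lim_{p\to\infty}$ denotes the limit along this regime. *)

theory Defs
  imports "HOL-Probability.Probability"
begin

text \<open>Vectors in R^p are functions nat => real (only indices < p matter);
  p x p matrices are functions nat => nat => real (only indices < p matter).\<close>

definition bil :: "nat \<Rightarrow> (nat \<Rightarrow> nat \<Rightarrow> real) \<Rightarrow> (nat \<Rightarrow> real) \<Rightarrow> (nat \<Rightarrow> real) \<Rightarrow> real" where
  "bil p A x y = (\<Sum>i<p. \<Sum>j<p. x i * A i j * y j)"

definition sym_pd :: "nat \<Rightarrow> (nat \<Rightarrow> nat \<Rightarrow> real) \<Rightarrow> bool" where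
  "sym_pd p A \<longleftrightarrow> (\<forall>i<p. \<forall>j<p. A i j = A j i) \<and>
     (\<forall>x. (\<exists>i<p. x i \<noteq> 0) \<longrightarrow> bil p A x x > 0)"

text \<open>Inverse of a p x p matrix (unique on indices < p when the matrix is invertible).\<close>
definition mat_inv :: "nat \<Rightarrow> (nat \<Rightarrow> nat \<Rightarrow> real) \<Rightarrow> (nat \<Rightarrow> nat \<Rightarrow> real)" where
  "mat_inv p A = (SOME B. \<forall>i<p. \<forall>j<p. (\<Sum>k<p. A i k * B k j) = (if i = j then 1 else 0))"

definition mat_det :: "nat \<Rightarrow> (nat \<Rightarrow> nat \<Rightarrow> real) \<Rightarrow> real" where
  "mat_det p A = (\<Sum>\<sigma>\<in>{\<sigma>. \<sigma> permutes {..<p}}. of_int (sign \<sigma>) * (\<Prod>i<p. A i (\<sigma> i)))"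

definition eta :: "nat \<Rightarrow> (nat \<Rightarrow> nat \<Rightarrow> real) \<Rightarrow> (nat \<Rightarrow> real) \<Rightarrow> (nat \<Rightarrow> real) \<Rightarrow> real" where
  "eta p S a b = bil p (mat_inv p S) (\<lambda>l. a l - b l) (\<lambda>l. a l - b l)"

definition Phi :: "real \<Rightarrow> real" where
  "Phi x = measure (density lborel std_normal_density) {..x}"

definition mvn_density :: "nat \<Rightarrow> (nat \<Rightarrow> real) \<Rightarrow> (nat \<Rightarrow> nat \<Rightarrow> real) \<Rightarrow> (nat \<Rightarrow> real) \<Rightarrow> real" where
  "mvn_density p mu S x =
     exp (- eta p S x mu / 2) / sqrt ((2 * pi) ^ p * mat_det p S)"

definition mvnormal :: "nat \<Rightarrow> (nat \<Rightarrow> real) \<Rightarrow> (nat \<Rightarrow> nat \<Rightarrow> real) \<Rightarrow> (nat \<Rightarrow> real) measure" where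
  "mvnormal p mu S = density (PiM {..<p} (\<lambda>_. lborel)) (\<lambda>x. ennreal (mvn_density p mu S x))"

text \<open>The sample S_n: X i k is the k-th point (k < n i) of class i (i < 2); the points
  are independent, class i points being N(mu i, S).\<close>
definition sample_measure :: "nat \<Rightarrow> (nat \<Rightarrow> nat) \<Rightarrow> (nat \<Rightarrow> nat \<Rightarrow> real) \<Rightarrow> (nat \<Rightarrow> nat \<Rightarrow> real)
     \<Rightarrow> (nat \<Rightarrow> nat \<Rightarrow> nat \<Rightarrow> real) measure" where
  "sample_measure p n mu S = PiM {..<2} (\<lambda>i. PiM {..<n i} (\<lambda>_. mvnormal p (mu i) S))"

definition sample_mean :: "nat \<Rightarrow> (nat \<Rightarrow> nat \<Rightarrow> nat \<Rightarrow> real) \<Rightarrow> nat \<Rightarrow> (nat \<Rightarrow> real)" where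
  "sample_mean n X i = (\<lambda>l. (\<Sum>k<n. X i k l) / real n)"

text \<open>Bayesian MMSE error estimator of class i, as a function of the class sample means
  xb 0, xb 1; m = prior means, nu = prior certainty, n = sample sizes.\<close>
definition eps_B :: "nat \<Rightarrow> (nat \<Rightarrow> nat \<Rightarrow> real) \<Rightarrow> real \<Rightarrow> (nat \<Rightarrow> nat) \<Rightarrow> (nat \<Rightarrow> real)
     \<Rightarrow> (nat \<Rightarrow> nat \<Rightarrow> real) \<Rightarrow> (nat \<Rightarrow> nat \<Rightarrow> real) \<Rightarrow> nat \<Rightarrow> real" where
  "eps_B p S c n nu m xb i =
     (let Si = mat_inv p S;
          d = (\<lambda>l. xb 0 l - xb 1 l);
          mid = (\<lambda>l. (xb 0 l + xb 1 l) / 2);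
          dhat = sqrt (bil p Si d d);
          mstar = (\<lambda>l. (real (n i) * xb i l + nu i * m i l) / (real (n i) + nu i));
          nustar = real (n i) + nu i
      in Phi ((-1) ^ i * ((- bil p Si (\<lambda>l. mstar l - mid l) d + c) / dhat)
               * sqrt (nustar / (nustar + 1))))"

definition GB :: "nat \<Rightarrow> (nat \<Rightarrow> nat \<Rightarrow> real) \<Rightarrow> real \<Rightarrow> (nat \<Rightarrow> real) \<Rightarrow> (nat \<Rightarrow> real) \<Rightarrow> real" where
  "GB i etamu delta2 J gam =
     (if i = 0 then
        1 / (2 * (1 + gam 0)) * (gam 0 * (etamu 0 1 - etamu 0 0) + delta2
           + (1 - gam 0) * J 0 + (1 + gam 0) * J 1)
      else
        -1 / (2 * (1 + gam 1)) * (gam 1 * (etamu 1 0 - etamu 1 1) + delta2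
           + (1 - gam 1) * J 1 + (1 + gam 1) * J 0))"

end

theory Submission
  imports Defs "Jordan_Normal_Form.Determinant"
begin

text \<open>
  Write the inverse covariance as \<open>K\<^sup>T K\<close> with \<open>K\<close> lower triangular. Integrating out one
  coordinate at a time shows that the whitened deviations \<open>K (x - \<mu>\<^sub>i)\<close> of the sample points have
  independent standard normal coordinates, so the whitened deviations of the sample means have
  independent \<open>N(0, 1/n\<^sub>i)\<close> coordinates. By Chebyshev's inequality the inner products of the sample
  means with each other and with fixed vectors converge in probability: the linear terms have variance
  of order \<open>1/n\<^sub>i\<close>, the cross term \<open>p/(n\<^sub>0 n\<^sub>1)\<close>, and the square of a deviation has mean
  \<open>p/n\<^sub>i\<close>, whence the limits \<open>J\<^sub>i\<close>, and variance \<open>2p/n\<^sub>i\<^sup>2\<close>. The error estimators are continuous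
  functions of these inner products, and being bounded by 1 their moments converge too.
\<close>

subsection \<open>Cholesky factor of the inverse covariance\<close>

text \<open>The dimension grows, so the sample means themselves have no limit; only finitely many
  inner products do, which is why the estimators are rewritten through them. A triangular factor
  turns the change of variables into a chain of one-dimensional affine substitutions, and its
  Jacobian, the product of the diagonal of \<open>K\<close>, is exactly what the normalising
  constant of the density contributes. The inner product of a class mean with itself keeps the extra
  term \<open>J i\<close>, since p coordinates of variance 1/n_i add up; between the classes nothing
  is left, because the deviations are independent and centred. Hence D is the limit of the squared
  distance between the sample means, and D > 0 keeps the quotient inside \<open>Phi\<close>
  continuous. All limits are constants, so expectations of products factorise although both
  estimators are computed from the same sample.\<close>

definition fmat :: "nat \<Rightarrow> (nat \<Rightarrow> nat \<Rightarrow> real) \<Rightarrow> real Matrix.mat" where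
  "fmat p A = Matrix.mat p p (\<lambda>(i, j). A i j)"

lemma fmat_carrier [simp]: "fmat p A \<in> carrier_mat p p"
  by (simp add: fmat_def)

lemma fmat_dim [simp]: "dim_row (fmat p A) = p" "dim_col (fmat p A) = p"
  by (simp_all add: fmat_def)

lemma fmat_index [simp]: "i < p \<Longrightarrow> j < p \<Longrightarrow> fmat p A $$ (i, j) = A i j"
  by (simp add: fmat_def)

lemma fmat_mult: "fmat p A * fmat p B = fmat p (\<lambda>i j. \<Sum>k<p. A i k * B k j)"
  by (rule eq_matI) (auto simp: scalar_prod_def atLeast0LessThan)

lemma fmat_eq_iff: "fmat p A = fmat p B \<longleftrightarrow> (\<forall>i<p. \<forall>j<p. A i j = B i j)"
  by (auto simp: mat_eq_iff)

lemma fmat_one: "1\<^sub>m p = fmat p (\<lambda>i j. if i = j then 1 else 0)"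
  by (rule eq_matI) auto

lemma det_fmat: "Determinant.det (fmat p A) = mat_det p A"
  unfolding mat_det_def det_def'[OF fmat_carrier] atLeast0LessThan
  by (intro sum.cong refl arg_cong2[where f = "(*)"] prod.cong)
     (auto simp: permutes_in_image[of _ "{..<p}", unfolded lessThan_iff])

lemma bil_cong:
  assumes "\<And>i. i < p \<Longrightarrow> x i = x' i" "\<And>i. i < p \<Longrightarrow> y i = y' i"
  shows "bil p A x y = bil p A x' y'"
  unfolding bil_def by (intro sum.cong refl) (auto simp: assms)

lemma bil_eq_sum: "bil p A x y = (\<Sum>i<p. x i * (\<Sum>j<p. A i j * y j))"
  by (simp add: bil_def sum_distrib_left mult.assoc)

text \<open>\<open>mat_inv\<close> is a choice, so it says something only once a right inverse
  exists. A singular matrix would have a nonzero kernel vector, on which the quadratic form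
  vanishes.\<close>

lemma mat_inv_right:
  assumes "sym_pd p S" "i < p" "j < p"
  shows "(\<Sum>k<p. S i k * mat_inv p S k j) = (if i = j then 1 else 0)"
proof -
  have "Determinant.det (fmat p S) \<noteq> 0"
  proof
    assume "Determinant.det (fmat p S) = 0"
    then obtain v where v: "v \<in> carrier_vec p" "v \<noteq> 0\<^sub>v p" "fmat p S *\<^sub>v v = 0\<^sub>v p"
      using det_0_iff_vec_prod_zero_field[OF fmat_carrier] by blast
    have dv: "dim_vec v = p" using v by auto
    have z: "(\<Sum>j<p. S i j * vec_index v j) = 0" if "i < p" for i
    proof -
      have "vec_index (fmat p S *\<^sub>v v) i = (\<Sum>j<p. S i j * vec_index v j)"
        using that dv by (simp add: scalar_prod_def atLeast0LessThan)
      then show ?thesis using v that by simp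
    qed
    have "\<exists>i<p. vec_index v i \<noteq> 0"
    proof (rule ccontr)
      assume "\<not> ?thesis"
      then have "v = 0\<^sub>v p" using dv by (intro eq_vecI) auto
      then show False using v by simp
    qed
    then have "bil p S (vec_index v) (vec_index v) > 0"
      using assms(1) by (auto simp: sym_pd_def)
    moreover have "bil p S (vec_index v) (vec_index v) = 0"
      by (simp add: bil_eq_sum z)
    ultimately show False by simp
  qed
  then have "fmat p S \<in> Units (ring_mat TYPE(real) p ())"
    by (intro det_non_zero_imp_unit) auto
  then obtain B where B: "B \<in> carrier_mat p p" "fmat p S * B = 1\<^sub>m p"
    by (auto simp: Units_def ring_mat_def)
  have "B = fmat p (\<lambda>i j. B $$ (i, j))"
    using B by (intro eq_matI) auto
  with B have "fmat p S * fmat p (\<lambda>i j. B $$ (i, j)) = 1\<^sub>m p" by simp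
  then have "\<exists>B. \<forall>i<p. \<forall>j<p. (\<Sum>k<p. S i k * B k j) = (if i = j then 1 else 0)"
    unfolding fmat_mult fmat_one fmat_eq_iff
    by (intro exI[of _ "\<lambda>i j. B $$ (i, j)"])
  from someI_ex[OF this] show ?thesis
    using assms unfolding mat_inv_def by blast
qed

lemma fmat_mat_inv:
  assumes "sym_pd p S"
  shows "fmat p S * fmat p (mat_inv p S) = 1\<^sub>m p"
  unfolding fmat_mult fmat_one fmat_eq_iff using mat_inv_right[OF assms] by blast

lemma mat_inv_left:
  assumes "sym_pd p S" "i < p" "j < p"
  shows "(\<Sum>k<p. mat_inv p S i k * S k j) = (if i = j then 1 else 0)"
  using mat_mult_left_right_inverse[OF fmat_carrier fmat_carrier fmat_mat_inv[OF assms(1)]]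
  unfolding fmat_mult fmat_one fmat_eq_iff using assms by blast

text \<open>With y = S^-1 x, the form of the inverse at x is the form of S at y, and y is nonzero
  because S y = x.\<close>

lemma sym_pd_mat_inv:
  assumes S: "sym_pd p S"
  shows "sym_pd p (mat_inv p S)"
  unfolding sym_pd_def
proof (intro conjI allI impI)
  define B where "B = mat_inv p S"
  fix i j assume ij: "i < p" "j < p"
  \<comment> \<open>Both \<open>B i j\<close> and \<open>B j i\<close> equal the (i, j) entry of B S
    B^T, by the symmetry of S and B S = 1.\<close>
  have "B i j = (\<Sum>k<p. B i k * (if k = j then 1 else 0))"
    using ij by (simp add: if_distrib cong: if_cong)
  also have "\<dots> = (\<Sum>k<p. B i k * (\<Sum>l<p. B j l * S l k))"
    using ij by (intro sum.cong refl) (auto simp: B_def mat_inv_left[OF S])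
  also have "\<dots> = (\<Sum>k<p. \<Sum>l<p. B i k * (B j l * S k l))"
    using S unfolding sum_distrib_left by (intro sum.cong refl) (auto simp: sym_pd_def)
  also have "\<dots> = (\<Sum>l<p. \<Sum>k<p. B i k * (B j l * S k l))"
    by (rule sum.swap)
  also have "\<dots> = (\<Sum>l<p. B j l * (\<Sum>k<p. B i k * S k l))"
    unfolding sum_distrib_left by (intro sum.cong refl) (simp add: mult_ac)
  also have "\<dots> = (\<Sum>l<p. B j l * (if i = l then 1 else 0))"
    using ij by (intro sum.cong refl) (auto simp: B_def mat_inv_left[OF S])
  also have "\<dots> = B j i"
    using ij by (simp add: if_distrib cong: if_cong)
  finally show "mat_inv p S i j = mat_inv p S j i" by (simp add: B_def)
next
  fix x :: "nat \<Rightarrow> real" assume x: "\<exists>i<p. x i \<noteq> 0"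
  define y where "y i = (\<Sum>j<p. mat_inv p S i j * x j)" for i
  have Sy: "(\<Sum>j<p. S i j * y j) = x i" if "i < p" for i
  proof -
    have "(\<Sum>j<p. S i j * y j) = (\<Sum>j<p. \<Sum>k<p. S i j * mat_inv p S j k * x k)"
      by (simp add: y_def sum_distrib_left mult.assoc)
    also have "\<dots> = (\<Sum>k<p. (\<Sum>j<p. S i j * mat_inv p S j k) * x k)"
      by (subst sum.swap) (simp add: sum_distrib_right)
    also have "\<dots> = (\<Sum>k<p. (if i = k then 1 else 0) * x k)"
      using that by (intro sum.cong refl) (auto simp: mat_inv_right[OF S])
    also have "\<dots> = x i" using that by (simp add: if_distrib[of "\<lambda>a. a * _"] cong: if_cong)
    finally show ?thesis .
  qed
  have "\<exists>i<p. y i \<noteq> 0"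
  proof (rule ccontr)
    assume "\<not> ?thesis"
    then have "\<And>i. i < p \<Longrightarrow> y i = 0" by blast
    then have "\<And>i. i < p \<Longrightarrow> x i = 0" using Sy by (metis (no_types, lifting) lessThan_iff mult_zero_right sum.neutral)
    with x show False by blast
  qed
  then have "0 < bil p S y y" using S by (auto simp: sym_pd_def)
  also have "bil p S y y = (\<Sum>i<p. y i * x i)"
    unfolding bil_eq_sum by (intro sum.cong refl) (simp add: Sy)
  also have "\<dots> = bil p (mat_inv p S) x x"
    unfolding bil_eq_sum y_def by (simp add: mult.commute)
  finally show "0 < bil p (mat_inv p S) x x" .
qed

text \<open>Since the factorisation is K^T K with \<open>K\<close> lower triangular, the induction
  splits off the last coordinate: the Schur complement of the last diagonal entry is again positive
  definite and is factored recursively.\<close>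

lemma cholesky:
  assumes "sym_pd p B"
  shows "\<exists>K. (\<forall>j<p. K j j > (0::real)) \<and> (\<forall>j<p. \<forall>l<p. j < l \<longrightarrow> K j l = 0) \<and>
    (\<forall>a<p. \<forall>b<p. B a b = (\<Sum>j<p. K j a * K j b))"
  using assms
proof (induction p arbitrary: B)
  case 0
  then show ?case by simp
next
  case (Suc p)
  have sym: "B i j = B j i" if "i < Suc p" "j < Suc p" for i j
    using Suc.prems that unfolding sym_pd_def by blast
  define c where "c = B p p"
  have bilSuc: "bil (Suc p) B x x = bil p B x x + 2 * x p * (\<Sum>i<p. x i * B i p) + x p * x p * c" for x
  proof -
    have "(\<Sum>j<p. x p * B p j * x j) = x p * (\<Sum>i<p. x i * B i p)"
      unfolding sum_distrib_left by (intro sum.cong refl) (auto simp: sym[of p] mult_ac)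
    moreover have "(\<Sum>i<p. x i * B i p * x p) = x p * (\<Sum>i<p. x i * B i p)"
      unfolding sum_distrib_left by (intro sum.cong refl) (auto simp: mult_ac)
    ultimately show ?thesis
      by (simp add: bil_def sum.distrib c_def algebra_simps)
  qed
  have c: "c > 0"
  proof -
    let ?x = "\<lambda>i. if i = p then 1 else 0 :: real"
    have "0 < bil (Suc p) B ?x ?x" using Suc.prems by (auto simp: sym_pd_def)
    then show ?thesis unfolding bilSuc by (simp add: bil_def)
  qed
  define B' where "B' a b = B a b - B a p * B b p / c" for a b
  have "sym_pd p B'"
    unfolding sym_pd_def
  proof (intro conjI allI impI)
    fix i j assume "i < p" "j < p" then show "B' i j = B' j i"
      using sym by (simp add: B'_def)
  next
    fix x :: "nat \<Rightarrow> real" assume "\<exists>i<p. x i \<noteq> 0"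
    define s where "s = (\<Sum>i<p. x i * B i p)"
    \<comment> \<open>This last coordinate minimises the quadratic form for given x; the minimum is
      the value of the Schur complement at x.\<close>
    define y where "y = x(p := - s / c)"
    have "\<exists>i<Suc p. y i \<noteq> 0" using \<open>\<exists>i<p. x i \<noteq> 0\<close>
      by (auto simp: y_def intro: less_SucI)
    then have "0 < bil (Suc p) B y y" using Suc.prems by (auto simp: sym_pd_def)
    also have "\<dots> = bil p B x x - s * s / c"
    proof -
      have "bil p B y y = bil p B x x" by (rule bil_cong) (auto simp: y_def)
      moreover have "(\<Sum>i<p. y i * B i p) = s" unfolding s_def by (intro sum.cong) (auto simp: y_def)
      ultimately show ?thesis unfolding bilSuc using c by (simp add: y_def field_simps)
    qed
    also have "s * s / c = (\<Sum>i<p. \<Sum>j<p. x i * (B i p * B j p / c) * x j)"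
      unfolding s_def sum_product sum_divide_distrib by (intro sum.cong refl) simp
    also have "bil p B x x - \<dots> = bil p B' x x"
      unfolding bil_def B'_def by (simp add: sum_subtractf algebra_simps)
    finally show "0 < bil p B' x x" .
  qed
  from Suc.IH[OF this] obtain K where K: "\<forall>j<p. K j j > (0::real)" "\<forall>j<p. \<forall>l<p. j < l \<longrightarrow> K j l = 0"
    "\<forall>a<p. \<forall>b<p. B' a b = (\<Sum>j<p. K j a * K j b)" by blast
  \<comment> \<open>The new last row alone produces the rank-one matrix subtracted in
    \<open>B'\<close> and also the whole last row and column of B; the zeros in column p keep the
    old rows out of them.\<close>
  define K' where "K' j l = (if j = p then B l p / sqrt c else if l = p then 0 else K j l)" for j l
  have "B a b = (\<Sum>j<Suc p. K' j a * K' j b)" if "a < Suc p" "b < Suc p" for a b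
  proof -
    have last: "K' p a * K' p b = B a p * B b p / c"
      using c by (simp add: K'_def real_sqrt_mult_self)
    have "(\<Sum>j<p. K' j a * K' j b) = (if a < p \<and> b < p then B' a b else 0)"
    proof (cases "a < p \<and> b < p")
      case True
      then show ?thesis using K(3) by (auto simp: K'_def intro!: sum.cong)
    next
      case False
      then have "a = p \<or> b = p" using that by auto
      then show ?thesis using False by (auto simp: K'_def intro!: sum.neutral)
    qed
    then show ?thesis using that c sym
      by (auto simp: last B'_def less_Suc_eq) (simp_all add: c_def)
  qed
  moreover have "\<forall>j<Suc p. K' j j > 0"
    using K(1) c by (auto simp: K'_def c_def less_Suc_eq)
  moreover have "\<forall>j<Suc p. \<forall>l<Suc p. j < l \<longrightarrow> K' j l = 0"
    using K(2) by (auto simp: K'_def)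
  ultimately show ?case by (intro exI[of _ K']) blast
qed

definition whiten :: "nat \<Rightarrow> (nat \<Rightarrow> nat \<Rightarrow> real) \<Rightarrow> (nat \<Rightarrow> real) \<Rightarrow> nat \<Rightarrow> real" where
  "whiten p K x j = (\<Sum>l<p. K j l * x l)"

text \<open>The last clause identifies the normalising constant of the density with the Jacobian of
  x -> K x.\<close>

definition whitening_matrix :: "nat \<Rightarrow> (nat \<Rightarrow> nat \<Rightarrow> real) \<Rightarrow> (nat \<Rightarrow> nat \<Rightarrow> real) \<Rightarrow> bool" where
  "whitening_matrix p S K \<longleftrightarrow> (\<forall>j<p. K j j > 0) \<and> (\<forall>j<p. \<forall>l<p. j < l \<longrightarrow> K j l = 0) \<and>
    (\<forall>x y. bil p (mat_inv p S) x y = (\<Sum>j<p. whiten p K x j * whiten p K y j)) \<and>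
    mat_det p S = 1 / (\<Prod>j<p. K j j)\<^sup>2"

lemma ex_whitening_matrix:
  assumes S: "sym_pd p S"
  shows "\<exists>K. whitening_matrix p S K"
proof -
  obtain K where K: "\<And>j. j < p \<Longrightarrow> K j j > 0" "\<And>j l. j < p \<Longrightarrow> l < p \<Longrightarrow> j < l \<Longrightarrow> K j l = 0"
    and B: "\<And>a b. a < p \<Longrightarrow> b < p \<Longrightarrow> mat_inv p S a b = (\<Sum>j<p. K j a * K j b)"
    using cholesky[OF sym_pd_mat_inv[OF S]] by metis
  have "bil p (mat_inv p S) x y = (\<Sum>j<p. (\<Sum>l<p. K j l * x l) * (\<Sum>l<p. K j l * y l))" for x y
  proof -
    have "bil p (mat_inv p S) x y = (\<Sum>a<p. \<Sum>b<p. \<Sum>j<p. (K j a * x a) * (K j b * y b))"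
      unfolding bil_def by (intro sum.cong refl) (auto simp: B sum_distrib_left sum_distrib_right mult_ac)
    also have "\<dots> = (\<Sum>j<p. \<Sum>a<p. \<Sum>b<p. (K j a * x a) * (K j b * y b))"
      by (subst (2) sum.swap, subst sum.swap) simp
    finally show ?thesis by (simp add: sum_product)
  qed
  \<comment> \<open>The determinants of S and of its inverse K^T K multiply to 1, and a triangular
    determinant is the product of the diagonal.\<close>
  moreover have "mat_det p S = 1 / (\<Prod>j<p. K j j)\<^sup>2"
  proof -
    have dK: "Determinant.det (fmat p K) = (\<Prod>j<p. K j j)"
      by (subst det_lower_triangular[OF _ fmat_carrier])
         (auto simp: K prod_list_diag_prod atLeast0LessThan intro!: prod.cong)
    have "fmat p (mat_inv p S) = transpose_mat (fmat p K) * fmat p K"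
      by (rule eq_matI) (auto simp: B scalar_prod_def atLeast0LessThan)
    then have "Determinant.det (fmat p (mat_inv p S)) = (\<Prod>j<p. K j j)\<^sup>2"
      by (simp add: det_mult[of _ p] det_transpose[OF fmat_carrier] dK power2_eq_square)
    moreover have "Determinant.det (fmat p S) * Determinant.det (fmat p (mat_inv p S)) = 1"
      using fmat_mat_inv[OF S] by (simp flip: det_mult[OF fmat_carrier fmat_carrier])
    ultimately have "mat_det p S * (\<Prod>j<p. K j j)\<^sup>2 = 1" by (simp add: det_fmat)
    moreover have "(\<Prod>j<p. K j j) > 0" using K by (auto intro!: prod_pos)
    moreover have "a = 1 / P\<^sup>2" if "a * P\<^sup>2 = 1" "P > 0" for a P :: real
      using that by (simp add: eq_divide_eq)
    ultimately show ?thesis by blast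
  qed
  ultimately have "whitening_matrix p S K"
    using K unfolding whitening_matrix_def whiten_def by blast
  then show ?thesis by blast
qed

lemma bil_mat_inv_whiten:
  "whitening_matrix p S K \<Longrightarrow> bil p (mat_inv p S) x y = (\<Sum>j<p. whiten p K x j * whiten p K y j)"
  unfolding whitening_matrix_def by blast

lemma bil_mat_inv_commute:
  assumes "sym_pd p S"
  shows "bil p (mat_inv p S) x y = bil p (mat_inv p S) y x"
  using ex_whitening_matrix[OF assms] by (auto simp: bil_mat_inv_whiten mult.commute)

lemma
  shows bil_add_left: "bil p A (\<lambda>l. x l + y l) z = bil p A x z + bil p A y z"
    and bil_diff_left: "bil p A (\<lambda>l. x l - y l) z = bil p A x z - bil p A y z"
    and bil_diff_right: "bil p A z (\<lambda>l. x l - y l) = bil p A z x - bil p A z y"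
    and bil_mult_left: "bil p A (\<lambda>l. a * x l) z = a * bil p A x z"
    and bil_divide_left: "bil p A (\<lambda>l. x l / a) z = bil p A x z / a"
  by (simp_all add: bil_def sum.distrib sum_subtractf sum_distrib_left sum_divide_distrib algebra_simps)

subsection \<open>The multivariate normal distribution\<close>

abbreviation std_normal :: "real measure" where
  "std_normal \<equiv> density lborel std_normal_density"

lemma prob_space_std_normal: "prob_space std_normal"
  by (rule prob_space_normal_density) simp

lemma nn_integral_affine:
  fixes c t :: real
  assumes "g \<in> borel_measurable borel" "c > 0"
  shows "(\<integral>\<^sup>+x. g (t + c * x) \<partial>lborel) = (\<integral>\<^sup>+x. g x \<partial>lborel) * ennreal (1 / c)"
proof -
  have "(\<integral>\<^sup>+x. g x \<partial>lborel) = ennreal c * (\<integral>\<^sup>+x. g (t + c * x) \<partial>lborel)"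
    using nn_integral_real_affine[OF assms(1), of c t] assms(2) by simp
  then have "(\<integral>\<^sup>+x. g x \<partial>lborel) * ennreal (1 / c) = (ennreal c * ennreal (1 / c)) * (\<integral>\<^sup>+x. g (t + c * x) \<partial>lborel)"
    by (simp add: mult_ac)
  also have "ennreal c * ennreal (1 / c) = 1"
    using assms(2) by (simp flip: ennreal_mult)
  finally show ?thesis by simp
qed

lemma triangular_measurable:
  fixes K :: "nat \<Rightarrow> nat \<Rightarrow> real" and t :: "nat \<Rightarrow> real" and g :: "nat \<Rightarrow> real \<Rightarrow> ennreal"
  assumes "\<And>j. g j \<in> borel_measurable borel" "p \<le> q"
  shows "(\<lambda>x. \<Prod>j<p. g j (t j + (\<Sum>l<Suc j. K j l * x l))) \<in> borel_measurable (PiM {..<q} (\<lambda>_. lborel))"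
proof (intro borel_measurable_prod_ennreal)
  fix j assume j: "j \<in> {..<p}"
  have "(\<lambda>x. x l) \<in> borel_measurable (PiM {..<q} (\<lambda>_. lborel :: real measure))" if "l \<in> {..<Suc j}" for l
    using measurable_component_singleton[of l "{..<q}" "\<lambda>_. lborel :: real measure"] that j assms(2)
    by simp
  then have "(\<lambda>x. t j + (\<Sum>l<Suc j. K j l * x l)) \<in> borel_measurable (PiM {..<q} (\<lambda>_. lborel))"
    by (intro borel_measurable_add borel_measurable_const borel_measurable_sum borel_measurable_times)
  from measurable_compose[OF this assms(1)]
  show "(\<lambda>x. g j (t j + (\<Sum>l<Suc j. K j l * x l))) \<in> borel_measurable (PiM {..<q} (\<lambda>_. lborel))" .
qed

text \<open>Only the last factor contains the last variable, so that variable is integrated first.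
  The other variables merely translate its argument, and by translation invariance the inner
  integral is a constant that can be pulled out.\<close>

lemma nn_integral_triangular:
  fixes K :: "nat \<Rightarrow> nat \<Rightarrow> real" and t :: "nat \<Rightarrow> real"
  assumes "\<And>j. j < p \<Longrightarrow> K j j > 0" "\<And>j. g j \<in> borel_measurable borel"
  shows "(\<integral>\<^sup>+x. (\<Prod>j<p. g j (t j + (\<Sum>l<Suc j. K j l * x l))) \<partial>PiM {..<p} (\<lambda>_. lborel)) =
    (\<Prod>j<p. (\<integral>\<^sup>+u. g j u \<partial>lborel) * ennreal (1 / K j j))"
  using assms(1)
proof (induction p)
  case 0
  interpret product_sigma_finite "\<lambda>_::nat. lborel :: real measure" by standard
  show ?case by (simp add: nn_integral_empty PiM_empty)
next
  case (Suc p)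
  note [measurable] = assms(2)
  interpret product_sigma_finite "\<lambda>_::nat. lborel :: real measure" by standard
  let ?f = "\<lambda>j x. g j (t j + (\<Sum>l<Suc j. K j l * x l))"
  have ins: "{..<Suc p} = insert p {..<p}" by auto
  have "(\<integral>\<^sup>+x. (\<Prod>j<Suc p. ?f j x) \<partial>PiM {..<Suc p} (\<lambda>_. lborel)) =
    (\<integral>\<^sup>+x. (\<integral>\<^sup>+y. (\<Prod>j<Suc p. ?f j (x(p := y))) \<partial>lborel) \<partial>PiM {..<p} (\<lambda>_. lborel))"
    unfolding ins
    using triangular_measurable[OF assms(2), where p = "Suc p" and q = "Suc p"]
    by (intro product_nn_integral_insert) (simp_all only: ins, auto)
  also have "\<dots> = (\<integral>\<^sup>+x. (\<Prod>j<p. ?f j x) * ((\<integral>\<^sup>+u. g p u \<partial>lborel) * ennreal (1 / K p p)) \<partial>PiM {..<p} (\<lambda>_. lborel))"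
  proof (intro nn_integral_cong)
    fix x :: "nat \<Rightarrow> real"
    have "(\<Prod>j<Suc p. ?f j (x(p := y))) = (\<Prod>j<p. ?f j x) * g p ((t p + (\<Sum>l<p. K p l * x l)) + K p p * y)" for y
    proof -
      have "(\<Prod>j<p. ?f j (x(p := y))) = (\<Prod>j<p. ?f j x)"
        by (intro prod.cong refl arg_cong2[where f = "(+)"] arg_cong[where f = "g _"] sum.cong) auto
      moreover have "(\<Sum>l<p. K p l * (x(p := y)) l) = (\<Sum>l<p. K p l * x l)"
        by (intro sum.cong) auto
      ultimately show ?thesis by (simp add: add.assoc)
    qed
    then show "(\<integral>\<^sup>+y. (\<Prod>j<Suc p. ?f j (x(p := y))) \<partial>lborel) =
      (\<Prod>j<p. ?f j x) * ((\<integral>\<^sup>+u. g p u \<partial>lborel) * ennreal (1 / K p p))"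
      using Suc.prems[of p] by (simp add: nn_integral_cmult nn_integral_affine[OF assms(2)])
  qed
  also have "\<dots> = (\<integral>\<^sup>+x. (\<Prod>j<p. ?f j x) \<partial>PiM {..<p} (\<lambda>_. lborel)) * ((\<integral>\<^sup>+u. g p u \<partial>lborel) * ennreal (1 / K p p))"
    by (intro nn_integral_multc triangular_measurable assms(2)) auto
  finally show ?case using Suc by simp
qed

lemma mvn_density_whiten:
  assumes "whitening_matrix p S K"
  shows "mvn_density p mu S x =
    (\<Prod>j<p. std_normal_density (whiten p K (\<lambda>l. x l - mu l) j) * K j j)"
proof -
  let ?w = "\<lambda>j. whiten p K (\<lambda>l. x l - mu l) j" and ?P = "\<Prod>j<p. K j j"
  have P: "?P > 0" using assms by (auto simp: whitening_matrix_def intro!: prod_pos)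
  have "eta p S x mu = (\<Sum>j<p. (?w j)\<^sup>2)"
    using assms by (simp add: eta_def whitening_matrix_def power2_eq_square)
  moreover have "sqrt ((2 * pi) ^ p * mat_det p S) = sqrt (2 * pi) ^ p / ?P"
    using assms P unfolding whitening_matrix_def
    by (simp add: real_sqrt_divide flip: real_sqrt_power)
  ultimately have "mvn_density p mu S x = exp (\<Sum>j<p. - (?w j)\<^sup>2 / 2) * (1 / sqrt (2 * pi)) ^ p * ?P"
    by (simp add: mvn_density_def sum_negf sum_divide_distrib power_divide)
  also have "\<dots> = (\<Prod>j<p. std_normal_density (?w j) * K j j)"
    by (simp add: std_normal_density_def prod.distrib exp_sum prod_dividef power_divide)
  finally show ?thesis .
qed

lemma whiten_measurable [measurable]:
  "(\<lambda>x. whiten p K (\<lambda>l. x l - mu l) j) \<in> borel_measurable (PiM {..<p} (\<lambda>_. lborel))"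
  unfolding whiten_def by measurable

lemma sets_mvnormal [measurable_cong, simp]: "sets (mvnormal p mu S) = sets (PiM {..<p} (\<lambda>_. lborel))"
  by (simp add: mvnormal_def)

lemma space_mvnormal [simp]: "space (mvnormal p mu S) = space (PiM {..<p} (\<lambda>_. lborel))"
  by (simp add: mvnormal_def)

text \<open>This is the independence and standard normality of the whitened coordinates, tested on
  boxes. The factors \<open>K j j\<close> of the density cancel the factors \<open>1 / K j j\<close>
  of the triangular substitution.\<close>

lemma emeasure_mvnormal_whiten:
  assumes K: "whitening_matrix p S K" and A: "\<And>j. j < p \<Longrightarrow> A j \<in> sets borel"
  shows "emeasure (mvnormal p mu S) {x \<in> space (PiM {..<p} (\<lambda>_. lborel)). \<forall>j<p. whiten p K (\<lambda>l. x l - mu l) j \<in> A j} =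
    (\<Prod>j<p. emeasure std_normal (A j))"
proof -
  \<comment> \<open>The default value {} makes every \<open>A' j\<close> Borel without a side
    condition on j, as automatic measurability needs.\<close>
  define A' where "A' j = (if j < p then A j else {})" for j
  have [measurable]: "A' j \<in> sets borel" for j using A by (auto simp: A'_def)
  let ?L = "PiM {..<p} (\<lambda>_::nat. lborel :: real measure)"
  let ?w = "\<lambda>x j. whiten p K (\<lambda>l. x l - mu l) j"
  let ?E = "{x \<in> space ?L. \<forall>j<p. ?w x j \<in> A j}"
  define g :: "nat \<Rightarrow> real \<Rightarrow> ennreal" where
    "g j u = ennreal (std_normal_density u) * indicator (A' j) u" for j u
  have [measurable]: "g j \<in> borel_measurable borel" for j unfolding g_def by measurable
  define t where "t j = - (\<Sum>l<p. K j l * mu l)" for j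
  have Kpos: "K j j > 0" if "j < p" for j using K that by (auto simp: whitening_matrix_def)
  \<comment> \<open>Triangularity cuts the sum after the diagonal term, which gives the form that
    can be integrated coordinate by coordinate; the mean goes into the offset
    \<open>t\<close>.\<close>
  have w: "?w x j = t j + (\<Sum>l<Suc j. K j l * x l)" if "j < p" for x j
  proof -
    have "(\<Sum>l<p. K j l * x l) = (\<Sum>l<Suc j. K j l * x l)"
      using K that by (intro sum.mono_neutral_right) (auto simp: whitening_matrix_def)
    then show ?thesis by (simp add: whiten_def t_def algebra_simps sum_subtractf)
  qed
  have E: "?E = {x \<in> space ?L. \<forall>j<p. ?w x j \<in> A' j}" by (auto simp: A'_def)
  have dens: "(\<lambda>x. ennreal (mvn_density p mu S x)) \<in> borel_measurable ?L"
    unfolding mvn_density_whiten[OF K] by measurable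
  have "?E \<in> sets ?L" unfolding E by measurable
  from emeasure_density[OF dens this]
  have "emeasure (mvnormal p mu S) ?E = (\<integral>\<^sup>+x. ennreal (mvn_density p mu S x) * indicator ?E x \<partial>?L)"
    unfolding mvnormal_def .
  also have "\<dots> = (\<integral>\<^sup>+x. (\<Prod>j<p. g j (t j + (\<Sum>l<Suc j. K j l * x l))) * (\<Prod>j<p. ennreal (K j j)) \<partial>?L)"
  proof (intro nn_integral_cong)
    fix x assume x: "x \<in> space ?L"
    have "(indicator ?E x :: ennreal) = (\<Prod>j<p. indicator (A' j) (?w x j))"
      using x unfolding E by (auto simp: indicator_def)
    moreover have "ennreal (mvn_density p mu S x) =
        (\<Prod>j<p. ennreal (std_normal_density (?w x j))) * (\<Prod>j<p. ennreal (K j j))"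
      unfolding mvn_density_whiten[OF K] using Kpos
      by (subst prod_ennreal[symmetric]) (auto simp: ennreal_mult less_imp_le prod.distrib)
    ultimately show "ennreal (mvn_density p mu S x) * indicator ?E x =
        (\<Prod>j<p. g j (t j + (\<Sum>l<Suc j. K j l * x l))) * (\<Prod>j<p. ennreal (K j j))"
      by (simp add: g_def prod.distrib w mult_ac cong: prod.cong_simp)
  qed
  also have "\<dots> = (\<Prod>j<p. (\<integral>\<^sup>+u. g j u \<partial>lborel) * ennreal (1 / K j j)) * (\<Prod>j<p. ennreal (K j j))"
    by (subst nn_integral_multc) (auto intro!: triangular_measurable simp: nn_integral_triangular Kpos simp del: sum.lessThan_Suc)
  also have "\<dots> = (\<Prod>j<p. (\<integral>\<^sup>+u. g j u \<partial>lborel) * (ennreal (1 / K j j) * ennreal (K j j)))"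
    by (simp add: prod.distrib mult.assoc)
  also have "\<dots> = (\<Prod>j<p. emeasure std_normal (A j))"
  proof (intro prod.cong refl)
    fix j assume "j \<in> {..<p}"
    then have "ennreal (1 / K j j) * ennreal (K j j) = 1"
      using Kpos[of j] by (simp flip: ennreal_mult)
    then show "(\<integral>\<^sup>+u. g j u \<partial>lborel) * (ennreal (1 / K j j) * ennreal (K j j)) = emeasure std_normal (A j)"
      using \<open>j \<in> {..<p}\<close> A by (simp add: emeasure_density g_def A'_def)
  qed
  finally show ?thesis .
qed

text \<open>The box with all sides equal to the real line is the whole space, so the total mass is a
  product of ones.\<close>

lemma prob_space_mvnormal:
  assumes "whitening_matrix p S K"
  shows "prob_space (mvnormal p mu S)"
proof
  interpret N: prob_space std_normal by (rule prob_space_std_normal)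
  show "emeasure (mvnormal p mu S) (space (mvnormal p mu S)) = 1"
    using emeasure_mvnormal_whiten[OF assms, of "\<lambda>_. UNIV" mu] N.emeasure_space_1 by simp
qed

section \<open>Joint law of the whitened sample points\<close>

lemma prob_space_sample_measure:
  assumes "whitening_matrix p S K"
  shows "prob_space (sample_measure p n mu S)"
  unfolding sample_measure_def by (intro prob_space_PiM prob_space_mvnormal[OF assms])

abbreviation samples :: "nat \<Rightarrow> (nat \<Rightarrow> nat) \<Rightarrow> (nat \<times> nat \<times> nat) set" where
  "samples p n \<equiv> SIGMA i:{..<2}. {..<n i} \<times> {..<p}"

text \<open>The triple (class, point, coordinate) flattens the nested products into one index set,
  so that a single independence statement covers all scalars.\<close>

definition noise :: "nat \<Rightarrow> (nat \<Rightarrow> nat \<Rightarrow> real) \<Rightarrow> (nat \<Rightarrow> nat \<Rightarrow> real) \<Rightarrow> nat \<times> nat \<times> nat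
    \<Rightarrow> (nat \<Rightarrow> nat \<Rightarrow> nat \<Rightarrow> real) \<Rightarrow> real" where
  "noise p K mu = (\<lambda>(i, k, j) X. whiten p K (\<lambda>l. X i k l - mu i l) j)"

lemma sample_component_measurable:
  assumes "i < 2" "k < n i"
  shows "(\<lambda>X. X i k) \<in> measurable (sample_measure p n mu S) (PiM {..<p} (\<lambda>_. lborel))"
proof -
  have "(\<lambda>X. X i) \<in> measurable (sample_measure p n mu S) (PiM {..<n i} (\<lambda>_. mvnormal p (mu i) S))"
    unfolding sample_measure_def using assms by (intro measurable_component_singleton) auto
  moreover have "(\<lambda>Y. Y k) \<in> measurable (PiM {..<n i} (\<lambda>_. mvnormal p (mu i) S)) (mvnormal p (mu i) S)"
    using assms by (intro measurable_component_singleton) auto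
  ultimately have "(\<lambda>X. X i k) \<in> measurable (sample_measure p n mu S) (mvnormal p (mu i) S)"
    by (rule measurable_compose)
  then show ?thesis by (simp cong: measurable_cong_sets)
qed

lemma sample_coord_measurable:
  assumes "i < 2" "k < n i" "l < p"
  shows "(\<lambda>X. X i k l) \<in> borel_measurable (sample_measure p n mu S)"
proof -
  have "(\<lambda>x. x l) \<in> borel_measurable (PiM {..<p} (\<lambda>_. lborel :: real measure))"
    using measurable_component_singleton[of l "{..<p}" "\<lambda>_. lborel :: real measure"] assms by simp
  from measurable_compose[OF _ this, of "\<lambda>X. X i k"] show ?thesis
    using assms(1,2) by (simp add: sample_component_measurable)
qed

lemma noise_measurable:
  assumes "t \<in> samples p n"
  shows "noise p K mu t \<in> borel_measurable (sample_measure p n mu S)"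
  using assms by (auto simp: noise_def intro!: measurable_compose[OF sample_component_measurable])

text \<open>A product measure is determined by its values on boxes. The preimage of a box is a
  nested product of sets of sample points, so its probability factors over classes, then points,
  then coordinates.\<close>

lemma distr_noise:
  assumes K: "whitening_matrix p S K"
  shows "distr (sample_measure p n mu S) (PiM (samples p n) (\<lambda>_. borel)) (\<lambda>X. \<lambda>t\<in>samples p n. noise p K mu t X) =
    PiM (samples p n) (\<lambda>_. std_normal)"
proof -
  interpret N: prob_space std_normal by (rule prob_space_std_normal)
  interpret PN: product_sigma_finite "\<lambda>_::nat \<times> nat \<times> nat. std_normal"
    by standard
  let ?T = "samples p n" and ?M = "sample_measure p n mu S"
  let ?L = "PiM {..<p} (\<lambda>_::nat. lborel :: real measure)"
  show ?thesis
  proof (rule PN.PiM_eqI)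
    show "sets (distr ?M (PiM ?T (\<lambda>_. borel)) (\<lambda>X. \<lambda>t\<in>?T. noise p K mu t X)) = sets (PiM ?T (\<lambda>_. std_normal))"
      by (simp cong: sets_PiM_cong)
  next
    fix A assume A: "\<And>t. t \<in> ?T \<Longrightarrow> A t \<in> sets std_normal"
    define E where "E i k = {x \<in> space ?L. \<forall>j<p. whiten p K (\<lambda>l. x l - mu i l) j \<in> A (i, k, j)}" for i k
    have Es: "E i k \<in> sets ?L" if "i < 2" "k < n i" for i k
    proof -
      define A' where "A' j = (if j < p then A (i, k, j) else {})" for j
      have [measurable]: "A' j \<in> sets borel" for j using A that by (auto simp: A'_def)
      have "E i k = {x \<in> space ?L. \<forall>j<p. whiten p K (\<lambda>l. x l - mu i l) j \<in> A' j}"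
        by (auto simp: E_def A'_def)
      also have "\<dots> \<in> sets ?L" by measurable
      finally show ?thesis .
    qed
    have pre: "(\<lambda>X. \<lambda>t\<in>?T. noise p K mu t X) -` PiE ?T A \<inter> space ?M = PiE {..<2} (\<lambda>i. PiE {..<n i} (E i))"
      by (auto simp: sample_measure_def space_PiM PiE_def Pi_def extensional_def E_def noise_def)
    have "emeasure (distr ?M (PiM ?T (\<lambda>_. borel)) (\<lambda>X. \<lambda>t\<in>?T. noise p K mu t X)) (PiE ?T A) =
      emeasure ?M (PiE {..<2} (\<lambda>i. PiE {..<n i} (E i)))"
      unfolding pre[symmetric] using A
      by (intro emeasure_distr measurable_restrict noise_measurable sets_PiM_I_finite) auto
    also have "\<dots> = (\<Prod>i<2. emeasure (PiM {..<n i} (\<lambda>_. mvnormal p (mu i) S)) (PiE {..<n i} (E i)))"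
    proof -
      interpret prob_space "PiM {..<n i} (\<lambda>_. mvnormal p (mu i) S)" for i
        by (intro prob_space_PiM prob_space_mvnormal[OF K])
      interpret product_sigma_finite "\<lambda>i. PiM {..<n i} (\<lambda>_. mvnormal p (mu i) S)" by standard
      show ?thesis unfolding sample_measure_def
        using Es by (intro emeasure_PiM sets_PiM_I_finite) auto
    qed
    also have "\<dots> = (\<Prod>i<2. \<Prod>k<n i. emeasure (mvnormal p (mu i) S) (E i k))"
    proof (intro prod.cong refl)
      fix i :: nat assume i: "i \<in> {..<2}"
      interpret prob_space "mvnormal p (mu i) S" by (rule prob_space_mvnormal[OF K])
      interpret product_sigma_finite "\<lambda>_::nat. mvnormal p (mu i) S" by standard
      show "emeasure (PiM {..<n i} (\<lambda>_. mvnormal p (mu i) S)) (PiE {..<n i} (E i)) =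
          (\<Prod>k<n i. emeasure (mvnormal p (mu i) S) (E i k))"
        using Es i by (intro emeasure_PiM) auto
    qed
    also have "\<dots> = (\<Prod>i<2. \<Prod>k<n i. \<Prod>j<p. emeasure std_normal (A (i, k, j)))"
      unfolding E_def using A by (intro prod.cong refl emeasure_mvnormal_whiten[OF K]) auto
    also have "\<dots> = (\<Prod>i<2. \<Prod>kj\<in>{..<n i} \<times> {..<p}. emeasure std_normal (A (i, kj)))"
      by (simp add: prod.cartesian_product split_def)
    also have "\<dots> = (\<Prod>t\<in>?T. emeasure std_normal (A t))"
      by (subst prod.Sigma) (auto simp: split_def)
    finally show "emeasure (distr ?M (PiM ?T (\<lambda>_. borel)) (\<lambda>X. \<lambda>t\<in>?T. noise p K mu t X)) (PiE ?T A) =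
      (\<Prod>t\<in>?T. emeasure std_normal (A t))" .
  qed auto
qed

lemma distributed_noise:
  assumes K: "whitening_matrix p S K" and t: "t \<in> samples p n"
  shows "distributed (sample_measure p n mu S) lborel (noise p K mu t) std_normal_density"
proof -
  let ?M = "sample_measure p n mu S"
  note [measurable] = noise_measurable
  have "distr ?M borel (noise p K mu t) =
      distr (distr ?M (PiM (samples p n) (\<lambda>_. borel)) (\<lambda>X. \<lambda>t\<in>samples p n. noise p K mu t X)) borel (\<lambda>x. x t)"
    using t by (subst distr_distr) (auto simp: comp_def intro!: measurable_restrict noise_measurable)
  also have "\<dots> = distr (PiM (samples p n) (\<lambda>_. std_normal)) std_normal (\<lambda>x. x t)"
    unfolding distr_noise[OF K] by (intro distr_cong) auto
  also have "\<dots> = std_normal"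
    by (rule distr_PiM_component[OF prob_space_std_normal t])
  finally have "distr ?M lborel (noise p K mu t) = std_normal"
    by (simp cong: distr_cong)
  then show ?thesis using noise_measurable[OF t] by (simp add: distributed_def)
qed

text \<open>Independence holds because the joint law is the product of its own marginals, all of
  them standard normal.\<close>

lemma indep_noise:
  assumes K: "whitening_matrix p S K" and ne: "samples p n \<noteq> {}"
  shows "prob_space.indep_vars (sample_measure p n mu S) (\<lambda>_. borel) (noise p K mu) (samples p n)"
proof -
  let ?M = "sample_measure p n mu S"
  interpret prob_space ?M by (rule prob_space_sample_measure[OF K])
  have "distr ?M borel (noise p K mu t) = std_normal" if "t \<in> samples p n" for t
    using distributed_noise[OF K that] by (simp add: distributed_def cong: distr_cong)
  then have "PiM (samples p n) (\<lambda>t. distr ?M borel (noise p K mu t)) = PiM (samples p n) (\<lambda>_. std_normal)"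
    by (intro PiM_cong) auto
  then show ?thesis
    by (subst indep_vars_iff_distr_eq_PiM'[OF ne noise_measurable]) (simp_all add: distr_noise[OF K])
qed

subsection \<open>Moments of sample means\<close>

text \<open>Injectivity makes the singletons \<open>{f j}\<close> disjoint blocks of the original
  family, and functions of disjoint blocks are independent.\<close>

lemma (in prob_space) indep_vars_reindex_inj:
  assumes X: "indep_vars (\<lambda>_. N) X I" and f: "inj_on f J" "f ` J \<subseteq> I"
  shows "indep_vars (\<lambda>_. N) (\<lambda>j. X (f j)) J"
proof -
  have r: "indep_vars (\<lambda>j. PiM {f j} (\<lambda>_. N)) (\<lambda>j x. restrict (\<lambda>i. X i x) {f j}) J"
  proof (rule indep_vars_restrict[OF X])
    show "disjoint_family_on (\<lambda>j. {f j}) J"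
      using f(1) by (auto simp: disjoint_family_on_def dest: inj_onD)
    show "{f j} \<subseteq> I" if "j \<in> J" for j
      using f(2) that by blast
  qed
  have "indep_vars (\<lambda>_. N) (\<lambda>j x. restrict (\<lambda>i. X i x) {f j} (f j)) J"
    by (rule indep_vars_compose2[OF r, of "\<lambda>j g. g (f j)" "\<lambda>_. N"])
       (rule measurable_component_singleton, simp)
  then show ?thesis by simp
qed

text \<open>After expanding the square, the mixed terms integrate to 0 by independence and centring.
  The form \<open>has_bochner_integral\<close> carries integrability along with the value.\<close>

lemma (in prob_space) second_moment_sum_indep:
  fixes Z :: "'i \<Rightarrow> 'a \<Rightarrow> real"
  assumes I: "finite I" and Z: "indep_vars (\<lambda>_. borel) Z I"
    and sq: "\<And>i. i \<in> I \<Longrightarrow> integrable M (\<lambda>x. (Z i x)\<^sup>2)"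
    and mean: "\<And>i. i \<in> I \<Longrightarrow> expectation (Z i) = 0"
  shows "has_bochner_integral M (\<lambda>x. (\<Sum>i\<in>I. Z i x)\<^sup>2) (\<Sum>i\<in>I. expectation (\<lambda>x. (Z i x)\<^sup>2))"
proof -
  have int: "integrable M (Z i)" if "i \<in> I" for i
  proof (rule square_integrable_imp_integrable)
    show "Z i \<in> borel_measurable M" using Z that unfolding indep_vars_def2 by blast
  qed (rule sq[OF that])
  have "has_bochner_integral M (\<lambda>x. Z i x * Z j x) (if i = j then expectation (\<lambda>x. (Z i x)\<^sup>2) else 0)"
    if ij: "i \<in> I" "j \<in> I" for i j
  proof (cases "i = j")
    case True
    then show ?thesis using sq[OF ij(1)] by (simp add: has_bochner_integral_iff power2_eq_square)
  next
    case False
    have "indep_vars (\<lambda>_. borel) Z {i, j}"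
      by (rule indep_vars_subset[OF Z]) (use ij in auto)
    moreover have "integrable M (Z k)" if "k \<in> {i, j}" for k
      using that ij int by auto
    ultimately have "expectation (\<lambda>x. \<Prod>k\<in>{i, j}. Z k x) = (\<Prod>k\<in>{i, j}. expectation (Z k))"
        "integrable M (\<lambda>x. \<Prod>k\<in>{i, j}. Z k x)"
      by (auto intro: indep_vars_lebesgue_integral indep_vars_integrable simp del: prod.insert)
    with False ij mean show ?thesis by (simp add: has_bochner_integral_iff)
  qed
  then have "has_bochner_integral M (\<lambda>x. \<Sum>i\<in>I. \<Sum>j\<in>I. Z i x * Z j x)
      (\<Sum>i\<in>I. \<Sum>j\<in>I. if i = j then expectation (\<lambda>x. (Z i x)\<^sup>2) else 0)"
    by (intro has_bochner_integral_sum)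
  then show ?thesis using I by (simp add: power2_eq_square sum_product)
qed

lemma distributed_has_bochner_integral:
  fixes f :: "real \<Rightarrow> real"
  assumes Y: "distributed M lborel Y f" and f: "\<And>x. f x \<ge> 0" and g: "g \<in> borel_measurable borel"
    and int: "has_bochner_integral lborel (\<lambda>x. f x * g x) v"
  shows "has_bochner_integral M (\<lambda>x. g (Y x)) (v :: real)"
  unfolding has_bochner_integral_iff
proof
  have g': "g \<in> borel_measurable lborel" using g by simp
  show "integrable M (\<lambda>x. g (Y x))"
    using distributed_integrable[OF Y g' f] int by (simp only: has_bochner_integral_iff)
  show "(\<integral>x. g (Y x) \<partial>M) = v"
    using distributed_integral[OF Y g' f] int by (simp only: has_bochner_integral_iff)
qed

text \<open>Used for k = 1 and k = 2, where the constant is s^2 and 3 s^4.\<close>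

lemma distributed_normal_moment:
  assumes "distributed M lborel Y (normal_density 0 s)" "s > 0"
  shows "has_bochner_integral M (\<lambda>x. Y x ^ (2 * k)) (fact (2 * k) / ((2 / s\<^sup>2) ^ k * fact k))"
  using normal_moment_even[OF assms(2), of 0 k]
  by (intro distributed_has_bochner_integral[OF assms(1)]) simp_all

lemma distributed_normal_mean:
  assumes "distributed M lborel Y (normal_density 0 s)" "s > 0"
  shows "has_bochner_integral M Y 0"
  using normal_moment_odd[OF assms(2), of 0 0]
  by (intro distributed_has_bochner_integral[OF assms(1), of "\<lambda>y. y"]) simp_all

section \<open>Second moments of the linear, square and cross terms\<close>

locale indep_normal_vectors = prob_space M
  for M :: "'a measure" and p :: nat and y :: "nat \<Rightarrow> nat \<Rightarrow> 'a \<Rightarrow> real" and s :: "nat \<Rightarrow> real" +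
  assumes s_pos: "\<And>i. i < 2 \<Longrightarrow> s i > 0"
    and indep: "indep_vars (\<lambda>_. borel) (\<lambda>(i, j). y i j) ({..<2} \<times> {..<p})"
    and normal: "\<And>i j. i < 2 \<Longrightarrow> j < p \<Longrightarrow> distributed M lborel (y i j) (normal_density 0 (s i))"
begin

lemma indep_row:
  assumes "i < 2"
  shows "indep_vars (\<lambda>_. borel) (y i) {..<p}"
proof -
  have "indep_vars (\<lambda>_. borel) (\<lambda>j. (\<lambda>(i, j). y i j) (i, j)) {..<p}"
    by (intro indep_vars_reindex_inj[OF indep] inj_onI) (use assms in auto)
  then show ?thesis by simp
qed

lemma second_moment_linear:
  assumes "i < 2"
  shows "has_bochner_integral M (\<lambda>x. (\<Sum>j<p. a j * y i j x)\<^sup>2) ((s i)\<^sup>2 * (\<Sum>j<p. (a j)\<^sup>2))"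
proof -
  have m: "has_bochner_integral M (\<lambda>x. (a j * y i j x)\<^sup>2) ((a j)\<^sup>2 * (s i)\<^sup>2)" if "j < p" for j
    using has_bochner_integral_mult_right[OF distributed_normal_moment[OF normal[OF assms that] s_pos[OF assms], of 1], of "(a j)\<^sup>2"]
    by (simp add: power_mult_distrib)
  have "has_bochner_integral M (\<lambda>x. (\<Sum>j<p. a j * y i j x)\<^sup>2)
      (\<Sum>j<p. expectation (\<lambda>x. (a j * y i j x)\<^sup>2))"
    using distributed_normal_mean[OF normal[OF assms] s_pos[OF assms]] m
    by (intro second_moment_sum_indep indep_vars_compose2[OF indep_row[OF assms], of "\<lambda>j u. a j * u"])
       (auto simp: has_bochner_integral_iff)
  also have "(\<Sum>j<p. expectation (\<lambda>x. (a j * y i j x)\<^sup>2)) = (\<Sum>j<p. (a j)\<^sup>2 * (s i)\<^sup>2)"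
    using m by (intro sum.cong refl has_bochner_integral_integral_eq) auto
  finally show ?thesis by (simp add: sum_distrib_left mult.commute)
qed

text \<open>Each y^2 - s^2 is centred with variance 3 s^4 - s^4 = 2 s^4, and the p summands are
  independent.\<close>

lemma second_moment_square:
  assumes "i < 2"
  shows "has_bochner_integral M (\<lambda>x. ((\<Sum>j<p. (y i j x)\<^sup>2) - real p * (s i)\<^sup>2)\<^sup>2) (2 * real p * (s i) ^ 4)"
proof -
  have m2: "has_bochner_integral M (\<lambda>x. (y i j x)\<^sup>2) ((s i)\<^sup>2)" if "j < p" for j
    using distributed_normal_moment[OF normal[OF assms that] s_pos[OF assms], of 1] by simp
  have m4: "has_bochner_integral M (\<lambda>x. (y i j x) ^ 4) (3 * (s i) ^ 4)" if "j < p" for j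
    using distributed_normal_moment[OF normal[OF assms that] s_pos[OF assms], of 2] s_pos[OF assms]
    by (simp add: fact_numeral power_divide)
  have m: "has_bochner_integral M (\<lambda>x. ((y i j x)\<^sup>2 - (s i)\<^sup>2)\<^sup>2) (2 * (s i) ^ 4)" if "j < p" for j
  proof -
    have "has_bochner_integral M (\<lambda>x. (y i j x) ^ 4 - 2 * (s i)\<^sup>2 * (y i j x)\<^sup>2 + (s i) ^ 4)
        (3 * (s i) ^ 4 - 2 * (s i)\<^sup>2 * (s i)\<^sup>2 + (s i) ^ 4)"
      by (intro has_bochner_integral_add has_bochner_integral_diff m4 m2 that has_bochner_integral_mult_right)
         (simp add: has_bochner_integral_iff prob_space)
    moreover have "(a\<^sup>2 - b\<^sup>2)\<^sup>2 = a ^ 4 - 2 * b\<^sup>2 * a\<^sup>2 + b ^ 4" for a b :: real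
      by (simp add: power4_eq_xxxx power2_eq_square algebra_simps)
    moreover have "3 * (s i) ^ 4 - 2 * (s i)\<^sup>2 * (s i)\<^sup>2 + (s i) ^ 4 = 2 * (s i) ^ 4"
      by (simp add: power4_eq_xxxx power2_eq_square)
    ultimately show ?thesis by simp
  qed
  have m0: "expectation (\<lambda>x. (y i j x)\<^sup>2 - (s i)\<^sup>2) = 0" if "j < p" for j
    using m2[OF that] by (simp add: has_bochner_integral_iff prob_space)
  have "has_bochner_integral M (\<lambda>x. (\<Sum>j<p. (y i j x)\<^sup>2 - (s i)\<^sup>2)\<^sup>2)
      (\<Sum>j<p. expectation (\<lambda>x. ((y i j x)\<^sup>2 - (s i)\<^sup>2)\<^sup>2))"
    using m m0
    by (intro second_moment_sum_indep indep_vars_compose2[OF indep_row[OF assms], of "\<lambda>j u. u\<^sup>2 - (s i)\<^sup>2"])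
       (auto simp: has_bochner_integral_iff)
  also have "(\<Sum>j<p. expectation (\<lambda>x. ((y i j x)\<^sup>2 - (s i)\<^sup>2)\<^sup>2)) = (\<Sum>j<p. 2 * (s i) ^ 4)"
    using m by (intro sum.cong refl has_bochner_integral_integral_eq) auto
  finally show ?thesis by (simp add: sum_subtractf mult_ac)
qed

text \<open>Independence enters twice: within a coordinate it gives the product mean 0 and second
  moment s_0^2 s_1^2, and across coordinates it makes the products orthogonal.\<close>

lemma second_moment_cross:
  "has_bochner_integral M (\<lambda>x. (\<Sum>j<p. y 0 j x * y 1 j x)\<^sup>2) (real p * ((s 0)\<^sup>2 * (s 1)\<^sup>2))"
proof -
  have pair: "indep_vars (\<lambda>_. borel) (\<lambda>i. y i j) {0, 1}" if "j < p" for j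
  proof -
    have "indep_vars (\<lambda>_. borel) (\<lambda>i. (\<lambda>(i, j). y i j) (i, j)) {0, 1}"
      by (intro indep_vars_reindex_inj[OF indep] inj_onI) (use that in auto)
    then show ?thesis by simp
  qed
  have m2: "has_bochner_integral M (\<lambda>x. (y i j x)\<^sup>2) ((s i)\<^sup>2)" if "i < 2" "j < p" for i j
    using distributed_normal_moment[OF normal[OF that] s_pos[OF that(1)], of 1] by simp
  have m: "has_bochner_integral M (\<lambda>x. (y 0 j x * y 1 j x)\<^sup>2) ((s 0)\<^sup>2 * (s 1)\<^sup>2)" if "j < p" for j
  proof -
    have sq: "indep_vars (\<lambda>_. borel) (\<lambda>i x. (y i j x)\<^sup>2) {0, 1}"
      by (rule indep_vars_compose2[OF pair[OF that], of "\<lambda>_ u. u\<^sup>2"]) simp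
    have int: "integrable M (\<lambda>x. (y i j x)\<^sup>2)" if "i \<in> {0, 1}" for i
      using m2[of i j] that \<open>j < p\<close> by (auto simp: has_bochner_integral_iff)
    from indep_vars_lebesgue_integral[OF _ sq int] indep_vars_integrable[OF _ sq int] m2[of 0 j] m2[of 1 j] that
    show ?thesis by (simp add: has_bochner_integral_iff power_mult_distrib)
  qed
  have m0: "expectation (\<lambda>x. y 0 j x * y 1 j x) = 0" if "j < p" for j
  proof -
    have mean: "has_bochner_integral M (y i j) 0" if "i \<in> {0, 1}" for i
      using distributed_normal_mean[OF normal s_pos, of i j] that \<open>j < p\<close> by auto
    then have "integrable M (y i j)" if "i \<in> {0, 1}" for i
      using that by (auto simp: has_bochner_integral_iff)
    from indep_vars_lebesgue_integral[OF _ pair[OF that] this] show ?thesis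
      using mean by (simp add: has_bochner_integral_iff)
  qed
  \<comment> \<open>The product for coordinate j is a function of the block {(0, j), (1, j)}, and
    these blocks are disjoint.\<close>
  have "indep_vars (\<lambda>_. borel)
      (\<lambda>j x. (\<lambda>f. f (0, j) * f (1, j)) (restrict (\<lambda>t. (\<lambda>(i, j). y i j) t x) {(0, j), (1, j)})) {..<p}"
    by (intro indep_vars_compose2[OF indep_vars_restrict[OF indep]])
       (auto simp: disjoint_family_on_def intro!: borel_measurable_times measurable_component_singleton)
  then have "indep_vars (\<lambda>_. borel) (\<lambda>j x. y 0 j x * y 1 j x) {..<p}" by simp
  then have "has_bochner_integral M (\<lambda>x. (\<Sum>j<p. y 0 j x * y 1 j x)\<^sup>2)
      (\<Sum>j<p. expectation (\<lambda>x. (y 0 j x * y 1 j x)\<^sup>2))"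
    using m m0 by (intro second_moment_sum_indep) (auto simp: has_bochner_integral_iff)
  also have "(\<Sum>j<p. expectation (\<lambda>x. (y 0 j x * y 1 j x)\<^sup>2)) = (\<Sum>j<p. (s 0)\<^sup>2 * (s 1)\<^sup>2)"
    using m by (intro sum.cong refl has_bochner_integral_integral_eq) auto
  finally show ?thesis by simp
qed

end

section \<open>Law of the whitened deviations of the sample means\<close>

definition mean_noise :: "nat \<Rightarrow> (nat \<Rightarrow> nat \<Rightarrow> real) \<Rightarrow> (nat \<Rightarrow> nat \<Rightarrow> real) \<Rightarrow> (nat \<Rightarrow> nat) \<Rightarrow> nat \<Rightarrow> nat
    \<Rightarrow> (nat \<Rightarrow> nat \<Rightarrow> nat \<Rightarrow> real) \<Rightarrow> real" where
  "mean_noise p K mu n i j X = whiten p K (\<lambda>l. sample_mean (n i) X i l - mu i l) j"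

lemma mean_noise_eq:
  assumes "n i > 0"
  shows "mean_noise p K mu n i j X = (\<Sum>k<n i. noise p K mu (i, k, j) X) / real (n i)"
proof -
  have "(\<Sum>k<n i. noise p K mu (i, k, j) X) = (\<Sum>l<p. \<Sum>k<n i. K j l * (X i k l - mu i l))"
    unfolding noise_def whiten_def prod.case by (rule sum.swap)
  also have "\<dots> = (\<Sum>l<p. K j l * ((\<Sum>k<n i. X i k l) - real (n i) * mu i l))"
    by (simp add: sum_distrib_left sum_subtractf right_diff_distrib mult.left_commute)
  finally have "(\<Sum>k<n i. noise p K mu (i, k, j) X) / real (n i) =
      (\<Sum>l<p. K j l * ((\<Sum>k<n i. X i k l) - real (n i) * mu i l) / real (n i))"
    by (simp only: sum_divide_distrib)
  also have "\<dots> = mean_noise p K mu n i j X"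
  proof -
    have "c * (a - real (n i) * m) / real (n i) = c * (a / real (n i) - m)" for a c m :: real
      using assms by (simp add: field_simps)
    then show ?thesis unfolding mean_noise_def whiten_def sample_mean_def by simp
  qed
  finally show ?thesis by simp
qed

text \<open>Each coordinate averages its own block of noise variables. A sum of n_i standard normals
  has standard deviation sqrt n_i, and division by n_i leaves 1 / sqrt n_i.\<close>

lemma indep_normal_mean_noise:
  assumes K: "whitening_matrix p S K" and p: "p > 0" and n: "\<And>i. i < 2 \<Longrightarrow> n i > 0"
  shows "indep_normal_vectors (sample_measure p n mu S) p (mean_noise p K mu n) (\<lambda>i. 1 / sqrt (real (n i)))"
proof -
  let ?M = "sample_measure p n mu S"
  interpret prob_space ?M by (rule prob_space_sample_measure[OF K])
  have "(0, 0, 0) \<in> samples p n" using p n[of 0] by simp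
  then have ind: "indep_vars (\<lambda>_. borel) (noise p K mu) (samples p n)"
    by (intro indep_noise[OF K]) blast
  show ?thesis
  proof
    fix i :: nat assume "i < 2" then show "0 < 1 / sqrt (real (n i))" using n by simp
  next
    \<comment> \<open>The block of all points of class i at coordinate j; distinct pairs (i, j) have
      disjoint blocks.\<close>
    let ?B = "\<lambda>(i, j). (\<lambda>k. (i, k, j)) ` {..<n i}"
    have "indep_vars (\<lambda>_. borel)
      (\<lambda>t x. (case t of (i, j) \<Rightarrow> \<lambda>f. (\<Sum>k<n i. f (i, k, j)) / real (n i)) (restrict (\<lambda>t. noise p K mu t x) (?B t)))
      ({..<2} \<times> {..<p})"
      by (intro indep_vars_compose2[OF indep_vars_restrict[OF ind]])
         (auto simp: disjoint_family_on_def intro!: borel_measurable_divide borel_measurable_sum measurable_component_singleton)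
    then show "indep_vars (\<lambda>_. borel) (\<lambda>(i, j). mean_noise p K mu n i j) ({..<2} \<times> {..<p})"
      by (rule indep_vars_cong[THEN iffD1, rotated -1]) (auto simp: mean_noise_eq n)
  next
    fix i j :: nat assume ij: "i < 2" "j < p"
    have "indep_vars (\<lambda>_. borel) (\<lambda>k. noise p K mu (i, k, j)) {..<n i}"
      by (intro indep_vars_reindex_inj[OF ind] inj_onI) (use ij in auto)
    then have "distributed ?M lborel (\<lambda>x. \<Sum>k<n i. noise p K mu (i, k, j) x)
        (normal_density (\<Sum>k<n i. 0) (sqrt (\<Sum>k<n i. 1\<^sup>2)))"
      using ij n[of i] by (intro sum_indep_normal distributed_noise[OF K]) auto
    then have "distributed ?M lborel (\<lambda>x. 0 + (1 / real (n i)) * (\<Sum>k<n i. noise p K mu (i, k, j) x))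
        (normal_density (0 + (1 / real (n i)) * 0) (\<bar>1 / real (n i)\<bar> * sqrt (real (n i))))"
      using n[of i] ij by (intro normal_density_affine) auto
    moreover have *: "mean_noise p K mu n i j = (\<lambda>x. (\<Sum>k<n i. noise p K mu (i, k, j) x) / real (n i))"
      using n[of i] ij by (simp add: mean_noise_eq fun_eq_iff)
    moreover have "\<bar>1 / real (n i)\<bar> * sqrt (real (n i)) = 1 / sqrt (real (n i))"
      using n[of i] ij by (simp add: field_simps)
    ultimately show "distributed ?M lborel (mean_noise p K mu n i j) (normal_density 0 (1 / sqrt (real (n i))))"
      using n[of i] ij by (simp add: *)
  qed
qed

subsection \<open>Convergence in probability\<close>

text \<open>
  The filter of events of asymptotic probability 1. Convergence in probability of random variables
  living on different spaces \<open>M p\<close> is convergence along this filter, so all limit laws apply to it.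
\<close>

definition prob_filter :: "(nat \<Rightarrow> 'a measure) \<Rightarrow> (nat \<times> 'a) filter" where
  "prob_filter M = Abs_filter (\<lambda>Q. \<exists>A. (\<forall>p. A p \<in> sets (M p)) \<and>
     (\<lambda>p. measure (M p) (A p)) \<longlonglongrightarrow> 1 \<and> (\<forall>p. \<forall>x\<in>A p. Q (p, x)))"

locale prob_spaces =
  fixes M :: "nat \<Rightarrow> 'a measure"
  assumes prob_space_M: "prob_space (M p)"
begin

text \<open>The filter axiom with content is closure under intersection, from P(A \<inter> B) \<ge>
  P(A) + P(B) - 1. Asking for a measurable witness A inside Q allows Q itself to be
  non-measurable.\<close>

lemma eventually_prob_filter:
  "eventually Q (prob_filter M) \<longleftrightarrow> (\<exists>A. (\<forall>p. A p \<in> sets (M p)) \<and>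
     (\<lambda>p. measure (M p) (A p)) \<longlonglongrightarrow> 1 \<and> (\<forall>p. \<forall>x\<in>A p. Q (p, x)))"
  unfolding prob_filter_def
proof (rule eventually_Abs_filter, rule is_filter.intro, goal_cases)
  case 1
  show ?case
    by (rule exI[of _ "\<lambda>p. space (M p)"]) (simp add: prob_space.prob_space[OF prob_space_M])
next
  case (2 P Q)
  then obtain A B where A: "\<And>p. A p \<in> sets (M p)" "(\<lambda>p. measure (M p) (A p)) \<longlonglongrightarrow> 1" "\<forall>p. \<forall>x\<in>A p. P (p, x)"
    and B: "\<And>p. B p \<in> sets (M p)" "(\<lambda>p. measure (M p) (B p)) \<longlonglongrightarrow> 1" "\<forall>p. \<forall>x\<in>B p. Q (p, x)"
    by blast
  have "(\<lambda>p. measure (M p) (A p \<inter> B p)) \<longlonglongrightarrow> 1"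
  proof (rule tendsto_sandwich[OF _ _ _ tendsto_const])
    have "measure (M p) (A p) + measure (M p) (B p) - 1 \<le> measure (M p) (A p \<inter> B p)" for p
    proof -
      interpret prob_space "M p" by (rule prob_space_M)
      have "prob (A p \<union> B p) = prob (A p) + prob (B p - A p)"
        using A(1)[of p] B(1)[of p] by (subst finite_measure_Union[symmetric]) auto
      moreover have "prob (B p) = prob (B p - A p) + prob (A p \<inter> B p)"
        using A(1)[of p] B(1)[of p] by (subst finite_measure_Union[symmetric]) (auto intro!: arg_cong[where f = prob])
      ultimately show ?thesis using prob_le_1[of "A p \<union> B p"] by simp
    qed
    then show "\<forall>\<^sub>F p in sequentially. measure (M p) (A p) + measure (M p) (B p) - 1 \<le> measure (M p) (A p \<inter> B p)"
      by simp
    show "\<forall>\<^sub>F p in sequentially. measure (M p) (A p \<inter> B p) \<le> 1"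
      using prob_space.prob_le_1[OF prob_space_M] by simp
    show "(\<lambda>p. measure (M p) (A p) + measure (M p) (B p) - 1) \<longlonglongrightarrow> 1"
      using tendsto_diff[OF tendsto_add[OF A(2) B(2)] tendsto_const[of 1]] by simp
  qed
  with A B show ?case by (intro exI[of _ "\<lambda>p. A p \<inter> B p"]) auto
next
  case (3 P Q)
  then show ?case by blast
qed

text \<open>Deterministic limits and facts valid for large p transfer to the filter through this:
  the witness is the whole space where the fact holds and empty elsewhere.\<close>

lemma filterlim_fst_prob_filter: "filterlim fst sequentially (prob_filter M)"
proof (rule filterlim_iff[THEN iffD2], intro allI impI)
  fix P :: "nat \<Rightarrow> bool" assume P: "eventually P sequentially"
  have "(\<lambda>p. measure (M p) (if P p then space (M p) else {})) \<longlonglongrightarrow> 1"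
    by (rule tendsto_eventually, use P in \<open>rule eventually_mono\<close>)
       (simp add: prob_space.prob_space[OF prob_space_M])
  then show "\<forall>\<^sub>F x in prob_filter M. P (fst x)"
    unfolding eventually_prob_filter
    by (intro exI[of _ "\<lambda>p. if P p then space (M p) else {}"]) (auto split: if_splits)
qed

lemma tendsto_prob_filter_const:
  "f \<longlonglongrightarrow> a \<Longrightarrow> ((\<lambda>z. f (fst z)) \<longlongrightarrow> a) (prob_filter M)"
  by (rule filterlim_compose[OF _ filterlim_fst_prob_filter])

text \<open>Chebyshev's inequality. The moment is required only for large p, since p or a sample
  size may be 0 before.\<close>

lemma tendsto_prob_filter_L2:
  fixes X :: "nat \<Rightarrow> 'a \<Rightarrow> real"
  assumes X: "\<forall>\<^sub>F p in sequentially. has_bochner_integral (M p) (\<lambda>x. (X p x)\<^sup>2) (v p)"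
    and v: "v \<longlonglongrightarrow> 0" and meas: "\<forall>\<^sub>F p in sequentially. X p \<in> borel_measurable (M p)"
  shows "((\<lambda>z. X (fst z) (snd z)) \<longlongrightarrow> 0) (prob_filter M)"
proof (rule tendstoI)
  fix e :: real assume e: "e > 0"
  \<comment> \<open>The empty default makes \<open>A p\<close> an event for every p; only large p
    affect the limit of its probability.\<close>
  define A where "A p = (if X p \<in> borel_measurable (M p) then {x \<in> space (M p). \<bar>X p x\<bar> < e} else {})" for p
  have "(\<lambda>p. measure (M p) (A p)) \<longlonglongrightarrow> 1"
  proof (rule tendsto_sandwich[OF _ _ _ tendsto_const])
    show "\<forall>\<^sub>F p in sequentially. 1 - v p / e\<^sup>2 \<le> measure (M p) (A p)"
      using X meas
    proof eventually_elim
      case (elim p)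
      interpret prob_space "M p" by (rule prob_space_M)
      note [measurable] = elim(2)
      have "prob {x \<in> space (M p). e\<^sup>2 \<le> (X p x)\<^sup>2} \<le> v p / e\<^sup>2"
        using elim(1) e integral_Markov_inequality_measure[of "M p" "\<lambda>x. (X p x)\<^sup>2" "{}" "e\<^sup>2"]
        by (simp add: has_bochner_integral_iff)
      also have "{x \<in> space (M p). e\<^sup>2 \<le> (X p x)\<^sup>2} = space (M p) - A p"
        using e elim(2) by (auto simp: A_def not_less abs_le_square_iff[symmetric])
      also have "prob \<dots> = 1 - prob (A p)"
        using elim(2) by (intro prob_compl) (auto simp: A_def)
      finally show ?case by simp
    qed
    show "(\<lambda>p. 1 - v p / e\<^sup>2) \<longlonglongrightarrow> 1"
      using tendsto_diff[OF tendsto_const[of 1] tendsto_divide[OF v tendsto_const[of "e\<^sup>2"]]] e by simp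
    show "\<forall>\<^sub>F p in sequentially. measure (M p) (A p) \<le> 1"
      using prob_space.prob_le_1[OF prob_space_M] by simp
  qed
  moreover have "A p \<in> sets (M p)" for p by (auto simp: A_def)
  moreover have "\<forall>p. \<forall>x\<in>A p. dist (X (fst (p, x)) (snd (p, x))) 0 < e"
    by (auto simp: A_def split: if_splits)
  ultimately show "\<forall>\<^sub>F z in prob_filter M. dist (X (fst z) (snd z)) 0 < e"
    unfolding eventually_prob_filter by blast
qed

text \<open>On a likely event Y is within e/2 of a; on the complement the constant \<open>C\<close>
  bounds the difference, and its contribution is \<open>C\<close> times a vanishing
  probability.\<close>

lemma tendsto_expectation_bounded:
  fixes Y :: "nat \<Rightarrow> 'a \<Rightarrow> real"
  assumes Y: "((\<lambda>z. Y (fst z) (snd z)) \<longlongrightarrow> a) (prob_filter M)"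
    and meas: "\<forall>\<^sub>F p in sequentially. Y p \<in> borel_measurable (M p)"
    and bound: "\<And>p x. \<bar>Y p x\<bar> \<le> B"
  shows "(\<lambda>p. integral\<^sup>L (M p) (Y p)) \<longlonglongrightarrow> a"
proof (rule tendstoI)
  fix e :: real assume e: "e > 0"
  define C where "C = B + \<bar>a\<bar>"
  \<comment> \<open>The bound at an arbitrary point already gives B \<ge> 0.\<close>
  have C: "C \<ge> 0" using bound[of undefined undefined] by (simp add: C_def)
  have "\<forall>\<^sub>F z in prob_filter M. dist (Y (fst z) (snd z)) a < e / 2"
    using tendstoD[OF Y, of "e / 2"] e by simp
  then obtain A where A: "\<And>p. A p \<in> sets (M p)" "(\<lambda>p. measure (M p) (A p)) \<longlonglongrightarrow> 1"
    "\<And>p x. x \<in> A p \<Longrightarrow> \<bar>Y p x - a\<bar> < e / 2"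
    unfolding eventually_prob_filter by (auto simp: dist_real_def)
  have "(\<lambda>p. e / 2 + C * (1 - measure (M p) (A p))) \<longlonglongrightarrow> e / 2 + C * (1 - 1)"
    by (intro tendsto_intros A)
  then have "\<forall>\<^sub>F p in sequentially. e / 2 + C * (1 - measure (M p) (A p)) < e"
    by (rule order_tendstoD(2)) (use e in simp)
  then show "\<forall>\<^sub>F p in sequentially. dist (integral\<^sup>L (M p) (Y p)) a < e"
    using meas
  proof eventually_elim
    case (elim p)
    interpret prob_space "M p" by (rule prob_space_M)
    note [measurable] = elim(2) A(1)
    have intY: "integrable (M p) (Y p)"
      by (rule integrable_const_bound[of _ B]) (auto simp: bound)
    have le: "\<bar>Y p x - a\<bar> \<le> e / 2 + C * indicator (space (M p) - A p) x" if "x \<in> space (M p)" for x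
    proof (cases "x \<in> A p")
      case True
      then show ?thesis using A(3)[of x p] by simp
    next
      case False
      have "\<bar>Y p x - a\<bar> \<le> C" using bound[of p x] unfolding C_def by linarith
      then show ?thesis using False that e by simp
    qed
    have "\<bar>integral\<^sup>L (M p) (Y p) - a\<bar> = \<bar>\<integral>x. Y p x - a \<partial>M p\<bar>"
      using intY by (simp add: prob_space)
    also have "\<dots> \<le> (\<integral>x. \<bar>Y p x - a\<bar> \<partial>M p)" by (rule integral_abs_bound)
    also have "\<dots> \<le> (\<integral>x. e / 2 + C * indicator (space (M p) - A p) x \<partial>M p)"
      using intY by (intro integral_mono le) (auto intro!: integrable_add integrable_mult_right simp: emeasure_eq_measure)
    also have "\<dots> = e / 2 + C * (1 - prob (A p))"
      using A(1)[of p] by (simp add: prob_space prob_compl emeasure_eq_measure)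
    finally show ?case using elim(1) by (simp add: dist_real_def)
  qed
qed

end

subsection \<open>The error estimator\<close>

lemma eta_eq_bil:
  assumes "sym_pd p S"
  shows "eta p S x y = bil p (mat_inv p S) x x - 2 * bil p (mat_inv p S) x y + bil p (mat_inv p S) y y"
  by (simp add: eta_def bil_diff_left bil_diff_right bil_mat_inv_commute[OF assms, of y x])

lemma Phi_eq_cdf: "Phi = cdf std_normal"
  by (simp add: Phi_def cdf_def fun_eq_iff)

text \<open>A distribution function is continuous wherever the measure has no atom.\<close>

lemma isCont_Phi: "isCont Phi x"
proof -
  interpret real_distribution std_normal
    by (simp add: real_distribution_def real_distribution_axioms_def prob_space_std_normal)
  have "emeasure std_normal {x} = 0"
    by (simp add: emeasure_density nn_integral_indicator_singleton)
  then show ?thesis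
    by (simp add: Phi_eq_cdf isCont_cdf measure_def)
qed

lemma Phi_measurable [measurable]: "Phi \<in> borel_measurable borel"
  by (intro borel_measurable_continuous_onI continuous_at_imp_continuous_on ballI isCont_Phi)

lemma Phi_nonneg: "0 \<le> Phi x"
  by (simp add: Phi_def)

lemma Phi_le_1: "Phi x \<le> 1"
  unfolding Phi_def by (rule prob_space.prob_le_1[OF prob_space_std_normal])

lemma bil_measurable:
  assumes "\<And>l. l < p \<Longrightarrow> (\<lambda>X. x X l) \<in> borel_measurable M" "\<And>l. l < p \<Longrightarrow> (\<lambda>X. y X l) \<in> borel_measurable M"
  shows "(\<lambda>X. bil p A (x X) (y X)) \<in> borel_measurable M"
  unfolding bil_def by (intro borel_measurable_sum borel_measurable_times borel_measurable_const assms) auto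

lemma sample_mean_measurable:
  assumes "i < 2" "l < p"
  shows "(\<lambda>X. sample_mean (n i) X i l) \<in> borel_measurable (sample_measure p n mu S)"
  unfolding sample_mean_def
  by (intro borel_measurable_divide borel_measurable_sum borel_measurable_const sample_coord_measurable assms) auto

lemma eps_B_measurable:
  assumes "i < 2"
  shows "(\<lambda>X. eps_B p S c n nu m (\<lambda>i. sample_mean (n i) X i) i) \<in> borel_measurable (sample_measure p n mu S')"
proof -
  note [intro] = sample_mean_measurable[of 0] sample_mean_measurable[of 1] sample_mean_measurable[OF assms]
  show ?thesis
    unfolding eps_B_def Let_def
    by (intro measurable_compose[OF _ Phi_measurable] borel_measurable_times borel_measurable_const
        borel_measurable_divide borel_measurable_add borel_measurable_uminus
        measurable_compose[OF _ borel_measurable_sqrt] bil_measurable borel_measurable_diff) (auto simp del: One_nat_def)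
qed

text \<open>Exhibits the estimator as a function of finitely many inner products. Numerator and
  denominator of the posterior mean are divided by n_i, because n_i and nu_i diverge while their
  ratio converges.\<close>

lemma eps_B_eq:
  fixes xb m :: "nat \<Rightarrow> nat \<Rightarrow> real" and nu :: "nat \<Rightarrow> real" and n :: "nat \<Rightarrow> nat" and i :: nat
  assumes "sym_pd p S" "n i > 0"
  defines "Q \<equiv> \<lambda>i j. bil p (mat_inv p S) (xb i) (xb j)" and "R \<equiv> \<lambda>j. bil p (mat_inv p S) (m i) (xb j)"
    and "r \<equiv> nu i / real (n i)"
  shows "eps_B p S c n nu m xb i =
    Phi ((-1) ^ i * ((- ((Q i 0 - Q i 1 + r * (R 0 - R 1)) / (1 + r) - (Q 0 0 - Q 1 1) / 2) + c)
      / sqrt (Q 0 0 - 2 * Q 0 1 + Q 1 1)) * sqrt ((real (n i) + nu i) / (real (n i) + nu i + 1)))"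
proof -
  have comm: "bil p (mat_inv p S) (xb 1) (xb 0) = bil p (mat_inv p S) (xb 0) (xb 1)"
    by (rule bil_mat_inv_commute[OF assms(1)])
  have r: "a / (real (n i) + nu i) = (a / real (n i)) / (1 + r)" for a
    using assms(2) by (simp add: r_def add_divide_distrib[symmetric] divide_divide_eq_left distrib_left)
  have d: "bil p (mat_inv p S) (\<lambda>l. xb 0 l - xb 1 l) (\<lambda>l. xb 0 l - xb 1 l) = Q 0 0 - 2 * Q 0 1 + Q 1 1"
    by (simp add: bil_diff_left bil_diff_right comm Q_def del: One_nat_def)
  have "bil p (mat_inv p S) (\<lambda>l. (real (n i) * xb i l + nu i * m i l) / (real (n i) + nu i) - (xb 0 l + xb 1 l) / 2)
      (\<lambda>l. xb 0 l - xb 1 l) =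
      (real (n i) * (Q i 0 - Q i 1) + nu i * (R 0 - R 1)) / (real (n i) + nu i) - (Q 0 0 - Q 1 1) / 2"
    by (simp add: bil_diff_left bil_diff_right bil_divide_left bil_add_left bil_mult_left comm Q_def R_def
        diff_divide_distrib add_divide_distrib right_diff_distrib del: One_nat_def)
  also have "(real (n i) * (Q i 0 - Q i 1) + nu i * (R 0 - R 1)) / (real (n i) + nu i) =
      (Q i 0 - Q i 1 + r * (R 0 - R 1)) / (1 + r)"
    unfolding r using assms(2) by (simp add: r_def add_divide_distrib)
  finally show ?thesis
    unfolding eps_B_def Let_def d by simp
qed

text \<open>The two positivity assumptions keep both denominators away from 0 in the limit.
  \<open>Qi0\<close> and \<open>Qi1\<close> are separate arguments so that one statement serves both
  classes.\<close>

lemma Phi_statistic_tendsto: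
  fixes Q00 Q01 Q11 Qi0 Qi1 R0 R1 r s :: "'z \<Rightarrow> real"
  assumes Q: "(Q00 \<longlongrightarrow> q00) F" "(Q01 \<longlongrightarrow> q01) F" "(Q11 \<longlongrightarrow> q11) F" "(Qi0 \<longlongrightarrow> qi0) F" "(Qi1 \<longlongrightarrow> qi1) F"
    and R: "(R0 \<longlongrightarrow> r0) F" "(R1 \<longlongrightarrow> r1) F" and rs: "(r \<longlongrightarrow> g) F" "(s \<longlongrightarrow> 1) F"
    and pos: "g \<ge> 0" "q00 - 2 * q01 + q11 > 0"
  shows "((\<lambda>z. Phi (a * ((- ((Qi0 z - Qi1 z + r z * (R0 z - R1 z)) / (1 + r z) - (Q00 z - Q11 z) / 2) + c)
      / sqrt (Q00 z - 2 * Q01 z + Q11 z)) * s z)) \<longlongrightarrow>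
    Phi (a * ((- ((qi0 - qi1 + g * (r0 - r1)) / (1 + g) - (q00 - q11) / 2) + c) / sqrt (q00 - 2 * q01 + q11)))) F"
proof -
  have "((\<lambda>z. a * ((- ((Qi0 z - Qi1 z + r z * (R0 z - R1 z)) / (1 + r z) - (Q00 z - Q11 z) / 2) + c)
      / sqrt (Q00 z - 2 * Q01 z + Q11 z)) * s z) \<longlongrightarrow>
    a * ((- ((qi0 - qi1 + g * (r0 - r1)) / (1 + g) - (q00 - q11) / 2) + c) / sqrt (q00 - 2 * q01 + q11)) * 1) F"
    using pos by (intro tendsto_intros Q R rs) auto
  from isCont_tendsto_compose[OF isCont_Phi this] show ?thesis by simp
qed

lemma one_less_2: "(1::nat) < 2"
  by simp

section \<open>Limits of the inner products in the asymptotic regime\<close>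

locale lda_regime =
  fixes Sig :: "nat \<Rightarrow> nat \<Rightarrow> nat \<Rightarrow> real"
    and mu m :: "nat \<Rightarrow> nat \<Rightarrow> nat \<Rightarrow> real"
    and n :: "nat \<Rightarrow> nat \<Rightarrow> nat"
    and nu :: "nat \<Rightarrow> nat \<Rightarrow> real"
    and J gam :: "nat \<Rightarrow> real"
  assumes spd: "\<And>p. sym_pd p (Sig p)"
    and n_inf: "\<And>i. i < 2 \<Longrightarrow> filterlim (\<lambda>p. n p i) at_top sequentially"
    and nu_inf: "\<And>i. i < 2 \<Longrightarrow> filterlim (\<lambda>p. nu p i) at_top sequentially"
    and J_lim: "\<And>i. i < 2 \<Longrightarrow> (\<lambda>p. real p / real (n p i)) \<longlonglongrightarrow> J i"
    and gam_lim: "\<And>i. i < 2 \<Longrightarrow> (\<lambda>p. nu p i / real (n p i)) \<longlonglongrightarrow> gam i"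
    and gam_nonneg: "\<And>i. i < 2 \<Longrightarrow> gam i \<ge> 0"
    and conv_m_mu: "\<And>i j. i < 2 \<Longrightarrow> j < 2 \<Longrightarrow>
          convergent (\<lambda>p. bil p (mat_inv p (Sig p)) (m p i) (mu p j))"
    and conv_m_m: "\<And>i j. i < 2 \<Longrightarrow> j < 2 \<Longrightarrow>
          convergent (\<lambda>p. bil p (mat_inv p (Sig p)) (m p i) (m p j))"
    and conv_mu_mu: "\<And>i j. i < 2 \<Longrightarrow> j < 2 \<Longrightarrow>
          convergent (\<lambda>p. bil p (mat_inv p (Sig p)) (mu p i) (mu p j))"
begin

abbreviation M where "M p \<equiv> sample_measure p (n p) (mu p) (Sig p)"
abbreviation B where "B p \<equiv> bil p (mat_inv p (Sig p))"
abbreviation xbar where "xbar p X i \<equiv> sample_mean (n p i) X i"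
abbreviation dev where "dev p X i \<equiv> (\<lambda>l. xbar p X i l - mu p i l)"

definition whitener :: "nat \<Rightarrow> nat \<Rightarrow> nat \<Rightarrow> real" where
  "whitener p = (SOME K. whitening_matrix p (Sig p) K)"

lemma whitener: "whitening_matrix p (Sig p) (whitener p)"
  unfolding whitener_def by (rule someI_ex[OF ex_whitening_matrix[OF spd]])

sublocale prob_spaces M
  by (rule prob_spaces.intro) (rule prob_space_sample_measure[OF whitener])

lemma eventually_n_pos:
  assumes "i < 2"
  shows "\<forall>\<^sub>F p in sequentially. n p i > 0"
proof -
  have "\<forall>\<^sub>F p in sequentially. 1 \<le> n p i"
    using n_inf[OF assms] unfolding filterlim_at_top by blast
  then show ?thesis by (rule eventually_mono) simp
qed

lemma eventually_indep:
  "\<forall>\<^sub>F p in sequentially. indep_normal_vectors (M p) p (mean_noise p (whitener p) (mu p) (n p))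
     (\<lambda>i. 1 / sqrt (real (n p i)))"
  using eventually_n_pos[OF pos2] eventually_n_pos[OF one_less_2] eventually_gt_at_top[of 0]
proof eventually_elim
  case (elim p)
  then show ?case
    by (intro indep_normal_mean_noise[OF whitener]) (auto simp: less_2_cases_iff)
qed

lemma whiten_dev: "whiten p (whitener p) (dev p X i) j = mean_noise p (whitener p) (mu p) (n p) i j X"
  by (simp add: mean_noise_def)

lemma dev_measurable: "i < 2 \<Longrightarrow> l < p \<Longrightarrow> (\<lambda>X. dev p X i l) \<in> borel_measurable (M p)"
  by (intro borel_measurable_diff sample_mean_measurable borel_measurable_const)

lemma inverse_n_tendsto: "i < 2 \<Longrightarrow> (\<lambda>p. 1 / real (n p i)) \<longlonglongrightarrow> 0"
  using filterlim_compose[OF lim_1_over_n n_inf[of i]] by simp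

text \<open>The variance is the quadratic form of a divided by n_i, so convergence of that form is
  enough; a will be a class mean or a prior mean.\<close>

lemma B_const_dev_tendsto:
  assumes "i < 2" "convergent (\<lambda>p. B p (a p) (a p))"
  shows "((\<lambda>z. B (fst z) (a (fst z)) (dev (fst z) (snd z) i)) \<longlongrightarrow> 0) (prob_filter M)"
proof (rule tendsto_prob_filter_L2)
  show "\<forall>\<^sub>F p in sequentially. has_bochner_integral (M p) (\<lambda>X. (B p (a p) (dev p X i))\<^sup>2)
      (1 / real (n p i) * B p (a p) (a p))"
    using eventually_indep
  proof eventually_elim
    case (elim p)
    then interpret indep_normal_vectors "M p" p "mean_noise p (whitener p) (mu p) (n p)" "\<lambda>i. 1 / sqrt (real (n p i))" .
    show ?case
      using second_moment_linear[OF assms(1), of "whiten p (whitener p) (a p)"]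
      by (simp add: bil_mat_inv_whiten[OF whitener] whiten_dev power2_eq_square)
  qed
  obtain L where "(\<lambda>p. B p (a p) (a p)) \<longlonglongrightarrow> L" using assms(2) by (auto simp: convergent_def)
  from tendsto_mult[OF inverse_n_tendsto[OF assms(1)] this]
  show "(\<lambda>p. 1 / real (n p i) * B p (a p) (a p)) \<longlonglongrightarrow> 0" by simp
  show "\<forall>\<^sub>F p in sequentially. (\<lambda>X. B p (a p) (dev p X i)) \<in> borel_measurable (M p)"
    by (intro always_eventually allI bil_measurable dev_measurable assms(1)) auto
qed

text \<open>The exact mean p/n_i is subtracted first. The variance 2p/n_i^2 is read as 2
  (p/n_i)(1/n_i), a convergent factor times a null one.\<close>

lemma B_dev_dev_tendsto:
  assumes "i < 2"
  shows "((\<lambda>z. B (fst z) (dev (fst z) (snd z) i) (dev (fst z) (snd z) i)) \<longlongrightarrow> J i) (prob_filter M)"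
proof -
  have inv_sqrt4: "(1 / sqrt (real N)) ^ 4 = 1 / real N * (1 / real N)" for N
    using power_mult[of "1 / sqrt (real N)" 2 2] by (simp add: power_divide power2_eq_square)
  have "((\<lambda>z. B (fst z) (dev (fst z) (snd z) i) (dev (fst z) (snd z) i) - real (fst z) / real (n (fst z) i)) \<longlongrightarrow> 0)
      (prob_filter M)"
  proof (rule tendsto_prob_filter_L2)
    show "\<forall>\<^sub>F p in sequentially. has_bochner_integral (M p)
        (\<lambda>X. (B p (dev p X i) (dev p X i) - real p / real (n p i))\<^sup>2)
        (2 * (real p / real (n p i)) * (1 / real (n p i)))"
      using eventually_indep
    proof eventually_elim
      case (elim p)
      then interpret indep_normal_vectors "M p" p "mean_noise p (whitener p) (mu p) (n p)" "\<lambda>i. 1 / sqrt (real (n p i))" .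
      show ?case
        using second_moment_square[OF assms(1)] unfolding inv_sqrt4
        by (simp add: bil_mat_inv_whiten[OF whitener] whiten_dev power2_eq_square)
    qed
    have "(\<lambda>p. 2 * (real p / real (n p i)) * (1 / real (n p i))) \<longlonglongrightarrow> 2 * J i * 0"
      by (intro tendsto_mult tendsto_const J_lim inverse_n_tendsto assms)
    then show "(\<lambda>p. 2 * (real p / real (n p i)) * (1 / real (n p i))) \<longlonglongrightarrow> 0" by simp
    show "\<forall>\<^sub>F p in sequentially. (\<lambda>X. B p (dev p X i) (dev p X i) - real p / real (n p i)) \<in> borel_measurable (M p)"
      by (intro always_eventually allI borel_measurable_diff bil_measurable dev_measurable assms(1)) auto
  qed
  from tendsto_add[OF this tendsto_prob_filter_const[OF J_lim[OF assms]]]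
  show ?thesis by simp
qed

lemma B_dev_cross_tendsto:
  "((\<lambda>z. B (fst z) (dev (fst z) (snd z) 0) (dev (fst z) (snd z) 1)) \<longlongrightarrow> 0) (prob_filter M)"
proof (rule tendsto_prob_filter_L2)
  show "\<forall>\<^sub>F p in sequentially. has_bochner_integral (M p)
      (\<lambda>X. (B p (dev p X 0) (dev p X 1))\<^sup>2) ((real p / real (n p 0)) * (1 / real (n p 1)))"
    using eventually_indep
  proof eventually_elim
    case (elim p)
    then interpret indep_normal_vectors "M p" p "mean_noise p (whitener p) (mu p) (n p)" "\<lambda>i. 1 / sqrt (real (n p i))" .
    show ?case
      using second_moment_cross
      by (simp add: bil_mat_inv_whiten[OF whitener] whiten_dev power2_eq_square)
  qed
  show "(\<lambda>p. (real p / real (n p 0)) * (1 / real (n p 1))) \<longlonglongrightarrow> 0"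
    using tendsto_mult[OF J_lim[of 0] inverse_n_tendsto[of 1]] by simp
  show "\<forall>\<^sub>F p in sequentially. (\<lambda>X. B p (dev p X 0) (dev p X 1)) \<in> borel_measurable (M p)"
    by (intro always_eventually allI bil_measurable dev_measurable) auto
qed

definition mu_lim where "mu_lim i j = lim (\<lambda>p. B p (mu p i) (mu p j))"
definition m_lim where "m_lim i j = lim (\<lambda>p. B p (m p i) (mu p j))"

lemma mu_lim: "i < 2 \<Longrightarrow> j < 2 \<Longrightarrow> (\<lambda>p. B p (mu p i) (mu p j)) \<longlonglongrightarrow> mu_lim i j"
  unfolding mu_lim_def using conv_mu_mu by (simp add: convergent_LIMSEQ_iff)

lemma mu_lim_commute: "mu_lim i j = mu_lim j i"
  unfolding mu_lim_def by (subst bil_mat_inv_commute[OF spd]) (rule refl)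

lemma m_lim: "i < 2 \<Longrightarrow> j < 2 \<Longrightarrow> (\<lambda>p. B p (m p i) (mu p j)) \<longlonglongrightarrow> m_lim i j"
  unfolding m_lim_def using conv_m_mu by (simp add: convergent_LIMSEQ_iff)

text \<open>Write each sample mean as class mean plus deviation; the two mixed terms vanish. Leaving
  \<open>L\<close> open covers the diagonal case \<open>J i\<close> and the off-diagonal case
  0.\<close>

lemma B_xbar_tendsto:
  assumes "i < 2" "j < 2" and dev: "((\<lambda>z. B (fst z) (dev (fst z) (snd z) i) (dev (fst z) (snd z) j)) \<longlongrightarrow> L) (prob_filter M)"
  shows "((\<lambda>z. B (fst z) (xbar (fst z) (snd z) i) (xbar (fst z) (snd z) j)) \<longlongrightarrow> mu_lim i j + L) (prob_filter M)"
proof -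
  have eq: "B p (xbar p X i) (xbar p X j) =
      B p (mu p i) (mu p j) + B p (mu p i) (dev p X j) + B p (mu p j) (dev p X i) + B p (dev p X i) (dev p X j)" for p X
    using bil_mat_inv_commute[OF spd, of p "mu p j" "xbar p X i"] bil_mat_inv_commute[OF spd, of p "mu p j" "mu p i"]
    by (simp add: bil_diff_left bil_diff_right)
  show ?thesis unfolding eq
    using tendsto_add[OF tendsto_add[OF tendsto_add[OF tendsto_prob_filter_const[OF mu_lim[OF assms(1,2)]]
          B_const_dev_tendsto[OF assms(2) conv_mu_mu[OF assms(1) assms(1)]]]
          B_const_dev_tendsto[OF assms(1) conv_mu_mu[OF assms(2) assms(2)]]] dev]
    by simp
qed

lemma B_m_xbar_tendsto:
  assumes "i < 2" "j < 2"
  shows "((\<lambda>z. B (fst z) (m (fst z) i) (xbar (fst z) (snd z) j)) \<longlongrightarrow> m_lim i j) (prob_filter M)"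
proof -
  have eq: "B p (m p i) (xbar p X j) = B p (m p i) (mu p j) + B p (m p i) (dev p X j)" for p X
    by (simp add: bil_diff_right)
  show ?thesis unfolding eq
    using tendsto_add[OF tendsto_prob_filter_const[OF m_lim[OF assms]]
        B_const_dev_tendsto[OF assms(2) conv_m_m[OF assms(1) assms(1)]]]
    by simp
qed

lemma delta2_eq: "lim (\<lambda>p. eta p (Sig p) (mu p 0) (mu p 1)) = mu_lim 0 0 - 2 * mu_lim 0 1 + mu_lim 1 1"
  unfolding eta_eq_bil[OF spd] by (intro limI tendsto_intros mu_lim) auto

text \<open>The limit of the quadratic form of the prior mean cancels in the difference, the only
  way in which \<open>etabar\<close> enters \<open>GB\<close>.\<close>

lemma etabar_diff:
  assumes i: "i < 2" and jk: "j < 2" "k < 2"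
  shows "lim (\<lambda>p. eta p (Sig p) (m p i) (mu p j)) - lim (\<lambda>p. eta p (Sig p) (m p i) (mu p k)) =
    2 * (m_lim i k - m_lim i j) + mu_lim j j - mu_lim k k"
proof -
  obtain L where L: "(\<lambda>p. B p (m p i) (m p i)) \<longlonglongrightarrow> L"
    using conv_m_m[OF i i] by (auto simp: convergent_def)
  have "lim (\<lambda>p. eta p (Sig p) (m p i) (mu p j)) = L - 2 * m_lim i j + mu_lim j j" if "j < 2" for j
    unfolding eta_eq_bil[OF spd] by (intro limI tendsto_intros mu_lim m_lim L i that)
  then show ?thesis using jk by simp
qed

abbreviation delta2 where "delta2 \<equiv> lim (\<lambda>p. eta p (Sig p) (mu p 0) (mu p 1))"
abbreviation etabar where "etabar \<equiv> \<lambda>i j. lim (\<lambda>p. eta p (Sig p) (m p i) (mu p j))"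

text \<open>Explains the coefficients of J in \<open>GB\<close>. For class 0, J_0 enters through the
  posterior mean as J_0/(1+g) and through the midpoint as -J_0/2, together (1-g)J_0/(2(1+g)); J_1
  enters only through the midpoint, as J_1/2. Class 1 is symmetric up to sign.\<close>

lemma GB_eq:
  assumes "i < 2"
  shows "GB i etabar delta2 J gam =
    ((mu_lim i 0 + (if i = 0 then J 0 else 0) - (mu_lim i 1 + (if i = 1 then J 1 else 0)) + gam i * (m_lim i 0 - m_lim i 1))
      / (1 + gam i)) - (mu_lim 0 0 + J 0 - (mu_lim 1 1 + J 1)) / 2"
proof -
  have pos: "1 + gam i > 0" using gam_nonneg[OF assms] by simp
  consider "i = 0" | "i = 1" using assms by linarith
  then show ?thesis
  proof cases
    case 1
    then show ?thesis using pos
      by (simp add: GB_def etabar_diff delta2_eq field_simps del: One_nat_def)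
  next
    case 2
    then show ?thesis using pos mu_lim_commute[of 1 0]
      by (simp add: GB_def etabar_diff delta2_eq field_simps del: One_nat_def)
  qed
qed

text \<open>The posterior uncertainty about the class mean disappears in the limit because nu* tends
  to infinity.\<close>

lemma nustar_ratio_tendsto:
  assumes "i < 2"
  shows "(\<lambda>p. sqrt ((real (n p i) + nu p i) / (real (n p i) + nu p i + 1))) \<longlonglongrightarrow> 1"
proof -
  have "filterlim (\<lambda>p. real (n p i) + nu p i) at_top sequentially"
    using filterlim_at_top_add_at_top[OF filterlim_compose[OF filterlim_real_sequentially n_inf[OF assms]] nu_inf[OF assms]] .
  moreover have "((\<lambda>x::real. sqrt (x / (x + 1))) \<longlongrightarrow> 1) at_top" by real_asymp
  ultimately show ?thesis by (rule filterlim_compose[rotated])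
qed

abbreviation EB where "EB c p X i \<equiv> eps_B p (Sig p) c (n p) (nu p) (m p) (xbar p X) i"

lemma EB_tendsto:
  assumes i: "i < 2" and D: "delta2 + J 0 + J 1 > 0"
  shows "((\<lambda>z. EB c (fst z) (snd z) i) \<longlongrightarrow>
    Phi ((-1) ^ i * ((- GB i etabar delta2 J gam + c) / sqrt (delta2 + J 0 + J 1)))) (prob_filter M)"
proof -
  \<comment> \<open>The limiting Gram matrix of the two sample means; the noise survives only on the
    diagonal.\<close>
  define q where "q i j = mu_lim i j + (if i = j then J i else 0)" for i j
  let ?Q = "\<lambda>z i j. B (fst z) (xbar (fst z) (snd z) i) (xbar (fst z) (snd z) j)"
  let ?R = "\<lambda>z j. B (fst z) (m (fst z) i) (xbar (fst z) (snd z) j)"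
  let ?r = "\<lambda>z::nat \<times> (nat \<Rightarrow> nat \<Rightarrow> nat \<Rightarrow> real). nu (fst z) i / real (n (fst z) i)"
  let ?s = "\<lambda>z::nat \<times> (nat \<Rightarrow> nat \<Rightarrow> nat \<Rightarrow> real). real (n (fst z) i) + nu (fst z) i"
  have Q01: "((\<lambda>z. ?Q z 0 1) \<longlongrightarrow> q 0 1) (prob_filter M)"
    using B_xbar_tendsto[OF _ _ B_dev_cross_tendsto] by (simp add: q_def)
  have "((\<lambda>z. ?Q z 1 0) \<longlongrightarrow> q 1 0) (prob_filter M)"
    using Q01 by (subst bil_mat_inv_commute[OF spd]) (simp add: q_def mu_lim_commute)
  then have Q: "((\<lambda>z. ?Q z i j) \<longlongrightarrow> q i j) (prob_filter M)" if "i < 2" "j < 2" for i j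
    using that Q01 B_xbar_tendsto[OF _ _ B_dev_dev_tendsto, of i] by (auto simp: q_def less_2_cases_iff)
  \<comment> \<open>D is thus the limit in probability of the squared distance of the sample means,
    the square of the denominator of the estimator.\<close>
  have D_eq: "delta2 + J 0 + J 1 = q 0 0 - 2 * q 0 1 + q 1 1"
    by (simp add: delta2_eq q_def del: One_nat_def)
  have G_eq: "GB i etabar delta2 J gam = (q i 0 - q i 1 + gam i * (m_lim i 0 - m_lim i 1)) / (1 + gam i) - (q 0 0 - q 1 1) / 2"
    using i by (subst GB_eq[OF i]) (auto simp: q_def less_2_cases_iff)
  note lim = Phi_statistic_tendsto[OF Q[OF pos2 pos2] Q01 Q[OF one_less_2 one_less_2]
      Q[OF i pos2] Q[OF i one_less_2] B_m_xbar_tendsto[OF i pos2] B_m_xbar_tendsto[OF i one_less_2]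
      tendsto_prob_filter_const[OF gam_lim[OF i]] tendsto_prob_filter_const[OF nustar_ratio_tendsto[OF i]]
      gam_nonneg[OF i] D[unfolded D_eq], of "(-1) ^ i" c]
  have "\<forall>\<^sub>F z in prob_filter M. n (fst z) i > 0"
    by (rule eventually_compose_filterlim[OF eventually_n_pos[OF i] filterlim_fst_prob_filter])
  then have "\<forall>\<^sub>F z in prob_filter M. EB c (fst z) (snd z) i =
    Phi ((-1) ^ i * ((- ((?Q z i 0 - ?Q z i 1 + ?r z * (?R z 0 - ?R z 1)) / (1 + ?r z) - (?Q z 0 0 - ?Q z 1 1) / 2) + c)
      / sqrt (?Q z 0 0 - 2 * ?Q z 0 1 + ?Q z 1 1)) * sqrt (?s z / (?s z + 1)))"
    by (rule eventually_mono) (rule eps_B_eq[OF spd])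
  from tendsto_cong[OF this, THEN iffD2, OF lim] show ?thesis
    unfolding D_eq G_eq .
qed

end

section \<open>Limits of the second moments of the estimators\<close>

theorem theorem3:
  fixes alpha0 :: real
    and Sig :: "nat \<Rightarrow> nat \<Rightarrow> nat \<Rightarrow> real"      (* Sig p : the p x p covariance matrix *)
    and mu m :: "nat \<Rightarrow> nat \<Rightarrow> nat \<Rightarrow> real"   (* mu p i, m p i : class mean / prior mean of class i in R^p *)
    and n :: "nat \<Rightarrow> nat \<Rightarrow> nat"                (* n p i : sample size of class i *)
    and nu :: "nat \<Rightarrow> nat \<Rightarrow> real"              (* nu p i : prior certainty of class i *)
    and J gam :: "nat \<Rightarrow> real"
  defines "c \<equiv> ln ((1 - alpha0) / alpha0)"
    and "delta2 \<equiv> lim (\<lambda>p. eta p (Sig p) (mu p 0) (mu p 1))"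
    and "etabar \<equiv> (\<lambda>i j. lim (\<lambda>p. eta p (Sig p) (m p i) (mu p j)))"
    and "D \<equiv> lim (\<lambda>p. eta p (Sig p) (mu p 0) (mu p 1)) + J 0 + J 1"
    and "EB \<equiv> (\<lambda>p X. eps_B p (Sig p) (ln ((1 - alpha0) / alpha0)) (n p) (nu p) (m p) (\<lambda>i. sample_mean (n p i) X i))"
  assumes alpha0: "0 < alpha0" "alpha0 < 1"
    and spd: "\<And>p. sym_pd p (Sig p)"
    and nu_pos: "\<And>p i. i < 2 \<Longrightarrow> nu p i > 0"
    and n_inf: "\<And>i. i < 2 \<Longrightarrow> filterlim (\<lambda>p. n p i) at_top sequentially"
    and nu_inf: "\<And>i. i < 2 \<Longrightarrow> filterlim (\<lambda>p. nu p i) at_top sequentially"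
    and J_lim: "\<And>i. i < 2 \<Longrightarrow> (\<lambda>p. real p / real (n p i)) \<longlonglongrightarrow> J i"
    and J_nonneg: "\<And>i. i < 2 \<Longrightarrow> J i \<ge> 0"
    and gam_lim: "\<And>i. i < 2 \<Longrightarrow> (\<lambda>p. nu p i / real (n p i)) \<longlonglongrightarrow> gam i"
    and gam_nonneg: "\<And>i. i < 2 \<Longrightarrow> gam i \<ge> 0"
    and conv_m_mu: "\<And>i j. i < 2 \<Longrightarrow> j < 2 \<Longrightarrow>
          convergent (\<lambda>p. bil p (mat_inv p (Sig p)) (m p i) (mu p j))"
    and conv_m_m: "\<And>i j. i < 2 \<Longrightarrow> j < 2 \<Longrightarrow>
          convergent (\<lambda>p. bil p (mat_inv p (Sig p)) (m p i) (m p j))"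
    and conv_mu_mu: "\<And>i j. i < 2 \<Longrightarrow> j < 2 \<Longrightarrow>
          convergent (\<lambda>p. bil p (mat_inv p (Sig p)) (mu p i) (mu p j))"
    and D_pos: "D > 0"
  shows "(\<forall>i<2. \<forall>j<2.
           (\<lambda>p. integral\<^sup>L (sample_measure p (n p) (mu p) (Sig p)) (\<lambda>X. EB p X i * EB p X j))
           \<longlonglongrightarrow> Phi ((-1) ^ i * ((- GB i etabar delta2 J gam + c) / sqrt D))
               * Phi ((-1) ^ j * ((- GB j etabar delta2 J gam + c) / sqrt D)))
       \<and> (\<lambda>p. integral\<^sup>L (sample_measure p (n p) (mu p) (Sig p))
                (\<lambda>X. (alpha0 * EB p X 0 + (1 - alpha0) * EB p X 1) ^ 2))
         \<longlonglongrightarrow> (alpha0 * Phi ((- GB 0 etabar delta2 J gam + c) / sqrt D)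
             + (1 - alpha0) * Phi ((GB 1 etabar delta2 J gam - c) / sqrt D)) ^ 2"
proof -
  interpret R: lda_regime Sig mu m n nu J gam
    using spd n_inf nu_inf J_lim gam_lim gam_nonneg conv_m_mu conv_m_m conv_mu_mu
    by (rule lda_regime.intro)
  let ?M = "\<lambda>p. sample_measure p (n p) (mu p) (Sig p)"
  define L where "L i = Phi ((-1) ^ i * ((- GB i etabar delta2 J gam + c) / sqrt D))" for i
  have lim: "((\<lambda>z. EB (fst z) (snd z) i) \<longlongrightarrow> L i) (prob_filter ?M)" if "i < 2" for i
    using R.EB_tendsto[OF that D_pos[unfolded D_def], of c]
    unfolding L_def EB_def etabar_def delta2_def D_def c_def .
  have meas: "(\<lambda>X. EB p X i) \<in> borel_measurable (?M p)" if "i < 2" for p i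
    unfolding EB_def by (rule eps_B_measurable[OF that])
  have bounds: "0 \<le> EB p X i" "EB p X i \<le> 1" for p X i
    unfolding EB_def eps_B_def Let_def by (rule Phi_nonneg Phi_le_1)+
  \<comment> \<open>Both factors tend in probability to constants, so the product does too; no
    independence between them is involved.\<close>
  have "(\<lambda>p. integral\<^sup>L (?M p) (\<lambda>X. EB p X i * EB p X j)) \<longlonglongrightarrow> L i * L j" if "i < 2" "j < 2" for i j
  proof (rule R.tendsto_expectation_bounded)
    show "((\<lambda>z. EB (fst z) (snd z) i * EB (fst z) (snd z) j) \<longlongrightarrow> L i * L j) (prob_filter ?M)"
      by (intro tendsto_mult lim that)
    show "\<forall>\<^sub>F p in sequentially. (\<lambda>X. EB p X i * EB p X j) \<in> borel_measurable (?M p)"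
      by (intro always_eventually allI borel_measurable_times meas that)
    show "\<bar>EB p X i * EB p X j\<bar> \<le> 1" for p X
      using bounds by (simp add: abs_mult mult_le_one)
  qed
  \<comment> \<open>The square is again a bounded continuous function of the estimators, so the same
    argument applies without expanding it.\<close>
  moreover have "(\<lambda>p. integral\<^sup>L (?M p) (\<lambda>X. (alpha0 * EB p X 0 + (1 - alpha0) * EB p X 1) ^ 2))
      \<longlonglongrightarrow> (alpha0 * L 0 + (1 - alpha0) * L 1) ^ 2"
  proof (rule R.tendsto_expectation_bounded)
    show "((\<lambda>z. (alpha0 * EB (fst z) (snd z) 0 + (1 - alpha0) * EB (fst z) (snd z) 1) ^ 2)
        \<longlongrightarrow> (alpha0 * L 0 + (1 - alpha0) * L 1) ^ 2) (prob_filter ?M)"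
      by (intro tendsto_intros lim pos2 one_less_2)
    show "\<forall>\<^sub>F p in sequentially. (\<lambda>X. (alpha0 * EB p X 0 + (1 - alpha0) * EB p X 1) ^ 2) \<in> borel_measurable (?M p)"
      by (intro always_eventually allI borel_measurable_power borel_measurable_add borel_measurable_times
          borel_measurable_const meas pos2 one_less_2)
    show "\<bar>(alpha0 * EB p X 0 + (1 - alpha0) * EB p X 1) ^ 2\<bar> \<le> 1" for p X
    proof -
      have "alpha0 * EB p X 0 + (1 - alpha0) * EB p X 1 \<le> 1"
        using bounds alpha0 by (intro convex_bound_le) auto
      moreover have "0 \<le> alpha0 * EB p X 0 + (1 - alpha0) * EB p X 1"
        using bounds alpha0 by (intro add_nonneg_nonneg mult_nonneg_nonneg) auto
      ultimately show ?thesis by (simp add: power_le_one)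
    qed
  qed
  moreover have "L 0 = Phi ((- GB 0 etabar delta2 J gam + c) / sqrt D)"
    by (simp add: L_def)
  moreover have "L 1 = Phi ((GB 1 etabar delta2 J gam - c) / sqrt D)"
  proof -
    \<comment> \<open>For class 1 the sign moves into the numerator, as in the stated form of the
      limit.\<close>
    have "(-1) ^ 1 * ((- g + c) / d) = (g - c) / d" for g d :: real
      by (simp add: diff_divide_distrib)
    then show ?thesis by (simp only: L_def)
  qed
  ultimately show ?thesis by (auto simp only: L_def)
qed

end
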